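(* Assume the standing assumptions on $k$ stated in the context, and suppose in addition that $$\int_1^\infty \frac{ds}{s\,\mathcal L(s)}<\infty .$$ Fix $\beta>0$ and, for $n\in\mathbb N$ and $t>0$, put $$\varkappa^{(n)}_t=\int_0^\infty G(s,t)\,e^{n\beta s}\,ds .$$ Then for each $n$ this integral is finite for almost every $t>0$, and $t\mapsto \varkappa^{(n)}_t$ coincides almost everywhere with a function that is real-analytic on $(0,\infty)$; we use this version. Moreover the intermittency property holds: for every $n>1$ and every decomposition $n=m_1+\dots+m_k$ with $k\ge 2$ and $m_1,\dots,m_k\in\mathbb N$, $$\frac{\varkappa^{(n)}_t}{\prod_{j=1}^k \varkappa^{(m_j)}_t}\longrightarrow\infty,\qquad t\to\infty .$$
   Context: Standing assumptions: $k:(0,\infty)\to[0,\infty)$ is locally integrable, its Laplace transform $\mathcal K(p)=\int_0^\infty e^{-pt}k(t)\,dt$ is finite for every $p>0$ and is a Stieltjes function, and $\mathcal L(p)=p\mathcal K(p)$. Moreover $\mathcal K(p)\to\infty$ as $p\to0^+$, $\mathcal K(p)\to0$ as $p\to\infty$, $\mathcal L(p)\to0$ as $p\to0^+$, and $\mathcal L(p)\to\infty$ as $p\to\infty$. A Stieltjes function is a function of the form $\varphi(\lambda)=a/\lambda+b+\int_{[0,\infty)}\frac{\sigma(dt)}{\lambda+t}$ with $a,b\ge0$ and $\sigma$ a Borel measure on $[0,\infty)$ such that $\int(1+t)^{-1}\sigma(dt)<\infty$. Under the standing assumptions $\mathcal L$ is a complete Bernstein function, and it admits the representation $\mathcal L(p)=\int_{[0,\infty)}\frac{p}{p+t}\,\sigma(dt)$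 for such a measure $\sigma$. For each $s\ge0$, $\mu_s$ denotes the probability measure on $[0,\infty)$ with $\int_{[0,\infty)} e^{-p\tau}\mu_s(d\tau)=e^{-s\mathcal L(p)}$ for all $p>0$; it exists by Bernstein's theorem. The subordination kernel is $G(s,t)=\int_{[0,t]}k(t-\tau)\,\mu_s(d\tau)$ for $s,t>0$. This kernel is nonnegative and satisfies $\int_0^\infty e^{-pt}G(s,t)\,dt=\mathcal K(p)e^{-s\mathcal L(p)}$. *)

theory Defs
  imports "HOL-Probability.Probability"
begin

definition stieltjes_function :: "(real \<Rightarrow> real) \<Rightarrow> bool" where
  "stieltjes_function \<phi> \<longleftrightarrow>
     (\<exists>a b (\<sigma> :: real measure).
        a \<ge> 0 \<and> b \<ge> 0 \<and> sets \<sigma> = sets borel \<and> emeasure \<sigma> {..<0} = 0 \<and>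
        (\<integral>\<^sup>+ t. ennreal (1 / (1 + t)) \<partial>\<sigma>) < \<infinity> \<and>
        (\<forall>x>0. \<phi> x = a / x + b + (\<integral> t. 1 / (x + t) \<partial>\<sigma>)))"

definition lapK :: "(real \<Rightarrow> real) \<Rightarrow> real \<Rightarrow> real" where
  "lapK k p = (LINT t:{0<..}|lborel. exp (- p * t) * k t)"

definition lapL :: "(real \<Rightarrow> real) \<Rightarrow> real \<Rightarrow> real" where
  "lapL k p = p * lapK k p"

definition standing_kernel :: "(real \<Rightarrow> real) \<Rightarrow> bool" where
  "standing_kernel k \<longleftrightarrow>
     (\<forall>t>0. k t \<ge> 0) \<and>
     (\<forall>a b. 0 < a \<longrightarrow> set_integrable lborel {a..b} k) \<and>
     (\<forall>p>0. set_integrable lborel {0<..} (\<lambda>t. exp (- p * t) * k t)) \<and>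
     stieltjes_function (lapK k) \<and>
     filterlim (lapK k) at_top (at_right 0) \<and>
     (lapK k \<longlongrightarrow> 0) at_top \<and>
     (lapL k \<longlongrightarrow> 0) (at_right 0) \<and>
     filterlim (lapL k) at_top at_top"

definition subordinator_laws :: "(real \<Rightarrow> real) \<Rightarrow> (real \<Rightarrow> real measure) \<Rightarrow> bool" where
  "subordinator_laws k \<mu> \<longleftrightarrow>
     (\<forall>s\<ge>0. prob_space (\<mu> s) \<and> sets (\<mu> s) = sets borel \<and> emeasure (\<mu> s) {..<0} = 0 \<and>
        (\<forall>p>0. (\<integral> \<tau>. exp (- p * \<tau>) \<partial>\<mu> s) = exp (- s * lapL k p)))"

definition subG :: "(real \<Rightarrow> real) \<Rightarrow> (real \<Rightarrow> real measure) \<Rightarrow> real \<Rightarrow> real \<Rightarrow> ennreal" where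
  "subG k \<mu> s t = (\<integral>\<^sup>+ \<tau>. ennreal (k (t - \<tau>)) * indicator {0..t} \<tau> \<partial>\<mu> s)"

definition kappa :: "(real \<Rightarrow> real) \<Rightarrow> (real \<Rightarrow> real measure) \<Rightarrow> real \<Rightarrow> nat \<Rightarrow> real \<Rightarrow> ennreal" where
  "kappa k \<mu> \<beta> n t = (\<integral>\<^sup>+ s. subG k \<mu> s t * ennreal (exp (real n * \<beta> * s)) * indicator {0<..} s \<partial>lborel)"

definition real_analytic_on :: "(real \<Rightarrow> real) \<Rightarrow> real set \<Rightarrow> bool" where
  "real_analytic_on f S \<longleftrightarrow>
     (\<forall>x\<in>S. \<exists>r>0. \<exists>c :: nat \<Rightarrow> real. \<forall>y. \<bar>y - x\<bar> < r \<longrightarrow> (\<lambda>i. c i * (y - x) ^ i) sums f y)"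

end

theory Submission
  imports Defs "HOL-Complex_Analysis.Complex_Analysis"
begin

text \<open>
  By Tonelli, the moment of order \<open>n\<close> has Laplace transform \<open>K / (L - a) = 1/p + a / (p (L(p) - a))\<close> with
  \<open>a = n \<beta>\<close>, for \<open>p\<close> beyond the root \<open>p\<^sub>0\<close> of \<open>L = a\<close>. The Stieltjes representation continues \<open>L\<close> to the
  plane slit along the nonpositive reals, where \<open>L(p) - a = (p - p\<^sub>0) S(p)\<close> with \<open>S\<close> free of zeros, and it gives
  \<open>|L(p)| \<ge> L(|p|)/6\<close> in the sector \<open>0 \<le> arg p \<le> 3\<pi>/4\<close>. After removal of the simple pole at \<open>p\<^sub>0\<close> the
  transform is therefore integrable, by the hypothesis on \<open>1 / (s L(s))\<close>, along a ray into the second quadrant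
  that starts at some \<open>c\<close> with \<open>0 < c < p\<^sub>0\<close>. Inverting it along this ray yields a real-analytic
  function of size \<open>O(e\<^sup>c\<^sup>t)\<close>, and the pole contributes \<open>C e\<^sup>p\<^sup>t\<close> with \<open>p = p\<^sub>0\<close> and \<open>C > 0\<close>; uniqueness of Laplace
  transforms identifies the sum with the moment. Intermittency then reduces to strict superadditivity
  of \<open>L\<^sup>-\<^sup>1\<close>, which holds because \<open>K = L(p)/p\<close> is strictly decreasing.
\<close>

section \<open>Uniqueness of Laplace transforms\<close>

text \<open>Measurability of \<open>s \<mapsto> \<mu> s\<close> is not among the hypotheses, so it
  has to be recovered from the Laplace transforms before Tonelli applies. The transform of the
  moment decays only like 1/p, which is not integrable at infinity: this is why 1/p, the transform
  of the constant 1, is split off, and why the pole is removed with a multiple of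
  \<open>1 / (p - p0) - 1 / (p + 1)\<close>, of order 1/p^2, whose second pole -1 lies on the cut
  and does no harm. The contour is tilted to the left because analyticity in t comes from the decay
  of \<open>exp (z t)\<close>, which a vertical contour does not offer. The transform is real on the
  positive axis, so the conjugate ray would contribute the conjugate value; one ray and an imaginary
  part suffice, and the real axis closes the contour. No inversion theorem is invoked: the ray
  integral is a candidate whose own Laplace transform is computed by Fubini and Cauchy.\<close>

text \<open>With \<open>x = exp (- t)\<close> a polynomial becomes a combination of
  \<open>exp (- i t)\<close>, so knowledge of a transform at the integers turns into knowledge on
  half-lines. The ramp \<open>\<phi> j\<close> climbs from 0 to 1 on the interval from
  \<open>x0 - 1/j\<close> to \<open>x0\<close>, hence converges pointwise to the closed indicator,
  the point \<open>x0\<close> included; Weierstrass replaces it by a polynomial. The uniform bound 2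
  is there for dominated convergence.\<close>

lemma step_function_polynomial_approx:
  fixes x0 :: real
  shows "\<exists>(N :: nat \<Rightarrow> nat) (c :: nat \<Rightarrow> nat \<Rightarrow> real). \<forall>x\<in>{0..1}.
    (\<forall>j. \<bar>\<Sum>i\<le>N j. c j i * x ^ i\<bar> \<le> 2) \<and>
    (\<lambda>j. \<Sum>i\<le>N j. c j i * x ^ i) \<longlonglongrightarrow> indicator {x0..} x"
proof -
  define \<phi> where "\<phi> j x = max 0 (min 1 (1 - real j * (x0 - x)))" for j x
  have "\<exists>N c. \<forall>x\<in>{0..1}. \<bar>\<phi> j x - (\<Sum>i\<le>N. c i * x ^ i)\<bar> < 1 / (real j + 1)" for j
  proof -
    have "continuous_on {0..1} (\<phi> j)"
      unfolding \<phi>_def by (intro continuous_intros)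
    from Stone_Weierstrass_real_polynomial_function[OF compact_Icc this, of "1 / (real j + 1)"]
    obtain g where "real_polynomial_function g" "\<And>x. x \<in> {0..1} \<Longrightarrow> \<bar>\<phi> j x - g x\<bar> < 1 / (real j + 1)"
      by auto
    then show ?thesis
      unfolding real_polynomial_function_iff_sum by blast
  qed
  then obtain N c where Nc: "\<And>j x. x \<in> {0..1} \<Longrightarrow> \<bar>\<phi> j x - (\<Sum>i\<le>N j. c j i * x ^ i)\<bar> < 1 / (real j + 1)"
    by metis
  show ?thesis
  proof (intro exI[of _ N] exI[of _ c] ballI conjI allI)
    fix j :: nat and x :: real assume x: "x \<in> {0..1}"
    have "\<bar>\<phi> j x\<bar> \<le> 1" by (auto simp: \<phi>_def)
    moreover have "1 / (real j + 1) \<le> 1" by simp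
    ultimately show "\<bar>\<Sum>i\<le>N j. c j i * x ^ i\<bar> \<le> 2" using Nc[OF x, of j] by linarith
  next
    fix x :: real assume x: "x \<in> {0..1}"
    have "(\<lambda>j. \<phi> j x) \<longlonglongrightarrow> indicator {x0..} x"
    proof (cases "x0 \<le> x")
      case True
      then have "\<phi> j x = 1" for j
        by (auto simp: \<phi>_def min_def max_def mult_nonneg_nonpos)
      then show ?thesis using True by simp
    next
      case False
      then have "\<forall>\<^sub>F j in sequentially. 1 \<le> real j * (x0 - x)"
        by real_asymp
      then have "\<forall>\<^sub>F j in sequentially. \<phi> j x = 0"
        by eventually_elim (auto simp: \<phi>_def)
      then show ?thesis using False by (simp add: tendsto_eventually)
    qed
    moreover have "(\<lambda>j. \<phi> j x - (\<Sum>i\<le>N j. c j i * x ^ i)) \<longlonglongrightarrow> 0"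
    proof (rule Lim_null_comparison)
      show "\<forall>\<^sub>F j in sequentially. norm (\<phi> j x - (\<Sum>i\<le>N j. c j i * x ^ i)) \<le> 1 / (real j + 1)"
        using Nc[OF x] by (auto intro!: always_eventually less_imp_le)
      show "(\<lambda>j. 1 / (real j + 1)) \<longlonglongrightarrow> 0" by real_asymp
    qed
    ultimately have "(\<lambda>j. \<phi> j x - (\<phi> j x - (\<Sum>i\<le>N j. c j i * x ^ i))) \<longlonglongrightarrow> indicator {x0..} x - 0"
      by (rule tendsto_diff)
    then show "(\<lambda>j. \<Sum>i\<le>N j. c j i * x ^ i) \<longlonglongrightarrow> indicator {x0..} x"
      by simp
  qed
qed

text \<open>The measures whose densities are the positive and the negative part of \<open>g\<close>
  agree, and are finite, on the generating half-lines. They therefore coincide, and so do their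
  densities almost everywhere; two parts of one number agree only if both vanish.\<close>

lemma integral_zero_on_rays_imp_AE_zero:
  fixes g :: "real \<Rightarrow> real"
  assumes g: "integrable lborel g"
    and zero: "\<And>x. (LINT t|lborel. indicator {x<..} t * g t) = 0"
  shows "AE t in lborel. g t = 0"
proof -
  have [measurable]: "g \<in> borel_measurable borel" using g by auto
  \<comment> \<open>\<open>ennreal\<close> sends negative reals to 0, so these densities are the
    positive and negative parts of \<open>g\<close>.\<close>
  define P where "P = density lborel (\<lambda>t. ennreal (g t))"
  define Q where "Q = density lborel (\<lambda>t. ennreal (- g t))"
  have ip: "integrable lborel (\<lambda>t. indicator {x<..} t * max 0 (g t))"
    and iq: "integrable lborel (\<lambda>t. indicator {x<..} t * max 0 (- g t))" for x
    using integrable_real_mult_indicator[of "{x<..}" lborel "\<lambda>t. max 0 (g t)"]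
      integrable_real_mult_indicator[of "{x<..}" lborel "\<lambda>t. max 0 (- g t)"] g
    by (simp_all add: mult.commute)
  have P: "emeasure P {x<..} = ennreal (LINT t|lborel. indicator {x<..} t * max 0 (g t))" for x
    unfolding P_def
    by (subst emeasure_density)
       (auto simp: nn_integral_eq_integral[OF ip, symmetric] ennreal_mult'' ennreal_indicator mult.commute
             intro!: nn_integral_cong split: split_indicator)
  have Q: "emeasure Q {x<..} = ennreal (LINT t|lborel. indicator {x<..} t * max 0 (- g t))" for x
    unfolding Q_def
    by (subst emeasure_density)
       (auto simp: nn_integral_eq_integral[OF iq, symmetric] ennreal_mult'' ennreal_indicator mult.commute
             intro!: nn_integral_cong split: split_indicator)
  have "(LINT t|lborel. indicator {x<..} t * max 0 (g t)) - (LINT t|lborel. indicator {x<..} t * max 0 (- g t)) = 0" for x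
  proof -
    have "(LINT t|lborel. indicator {x<..} t * max 0 (g t)) - (LINT t|lborel. indicator {x<..} t * max 0 (- g t))
      = (LINT t|lborel. indicator {x<..} t * max 0 (g t) - indicator {x<..} t * max 0 (- g t))"
      using ip iq by (rule Bochner_Integration.integral_diff[symmetric])
    also have "\<dots> = (LINT t|lborel. indicator {x<..} t * g t)"
      by (intro Bochner_Integration.integral_cong) (auto split: split_indicator)
    finally show ?thesis using zero by simp
  qed
  then have "emeasure P {x<..} = emeasure Q {x<..}" for x
    unfolding P Q by simp
  moreover have "emeasure P {x<..} < \<infinity>" for x
    by (simp add: P)
  moreover have "sets P = sets borel" "sets Q = sets borel"
    by (simp_all add: P_def Q_def)
  ultimately have "P = Q"
    by (intro measure_eqI_lessThan)
  then have "AE t in lborel. ennreal (g t) = ennreal (- g t)"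
    unfolding P_def Q_def by (intro sigma_finite_measure.density_unique[OF sigma_finite_lborel]) auto
  then show ?thesis
  proof eventually_elim
    case (elim t)
    then show ?case
      by (cases "0 \<le> g t") (simp_all add: ennreal_neg ennreal_eq_0_iff)
  qed
qed

text \<open>Lerch's theorem with integer nodes only: all moments of \<open>h\<close> in the variable
  \<open>exp (- t)\<close> vanish, and polynomials approximate step functions boundedly on the unit
  interval.\<close>

lemma laplace_zero_imp_AE_zero:
  fixes h :: "real \<Rightarrow> real"
  assumes h: "set_integrable lborel {0<..} h"
    and zero: "\<And>n::nat. (LINT t:{0<..}|lborel. exp (- real n * t) * h t) = 0"
  shows "AE t in lborel. t > 0 \<longrightarrow> h t = 0"
proof -
  define g where "g t = indicator {0<..} t * h t" for t
  have g: "integrable lborel g"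
    using h unfolding set_integrable_def g_def by simp
  have [measurable]: "g \<in> borel_measurable borel" using g by auto
  have zero': "(LINT t|lborel. exp (- t) ^ n * g t) = 0" for n
    using zero[of n]
    by (simp add: set_lebesgue_integral_def g_def exp_of_nat_mult[symmetric] mult.left_commute)
  have le1: "AE t in lborel. g t = 0 \<or> exp (- t) \<in> {0..1}"
    by (auto simp: g_def indicator_def)
  have int: "integrable lborel (\<lambda>t. exp (- t) ^ n * g t)" for n
  proof (rule Bochner_Integration.integrable_bound[OF g])
    show "AE t in lborel. norm (exp (- t) ^ n * g t) \<le> norm (g t)"
      using le1 by eventually_elim (elim disjE, simp, simp add: abs_mult mult_left_le_one_le power_le_one)
  qed auto
  have "(LINT t|lborel. indicator {x<..} t * g t) = 0" for x
  proof -
    obtain N :: "nat \<Rightarrow> nat" and c :: "nat \<Rightarrow> nat \<Rightarrow> real" where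
      Nc: "\<forall>y\<in>{0..1}. (\<forall>j. \<bar>\<Sum>i\<le>N j. c j i * y ^ i\<bar> \<le> 2) \<and>
        (\<lambda>j. \<Sum>i\<le>N j. c j i * y ^ i) \<longlonglongrightarrow> indicator {exp (- x)..} y"
      using step_function_polynomial_approx[of "exp (- x)"] by (elim exE)
    have bd: "\<bar>\<Sum>i\<le>N j. c j i * y ^ i\<bar> \<le> 2" if "y \<in> {0..1}" for j y
      using Nc that by blast
    have lim: "(\<lambda>j. \<Sum>i\<le>N j. c j i * y ^ i) \<longlonglongrightarrow> indicator {exp (- x)..} y" if "y \<in> {0..1}" for y
      using Nc that by blast
    have "(\<lambda>j. LINT t|lborel. (\<Sum>i\<le>N j. c j i * exp (- t) ^ i) * g t) \<longlonglongrightarrow>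
          (LINT t|lborel. indicator {..x} t * g t)"
    proof (rule integral_dominated_convergence[where w = "\<lambda>t. 2 * \<bar>g t\<bar>"])
      show "AE t in lborel. (\<lambda>j. (\<Sum>i\<le>N j. c j i * exp (- t) ^ i) * g t) \<longlonglongrightarrow> indicator {..x} t * g t"
        using le1
      proof eventually_elim
        case (elim t)
        \<comment> \<open>The substitution reverses the order, so an upper half-line in
          \<open>exp (- t)\<close> is a lower half-line in t.\<close>
        have "indicator {exp (- x)..} (exp (- t)) = (indicator {..x} t :: real)"
          by (auto simp: indicator_def)
        then show ?case
            using elim lim[of "exp (- t)"] by (cases "g t = 0") (simp, auto intro!: tendsto_mult)
      qed
      show "AE t in lborel. norm ((\<Sum>i\<le>N j. c j i * exp (- t) ^ i) * g t) \<le> 2 * \<bar>g t\<bar>" for j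
        using le1 by eventually_elim (elim disjE, simp, auto simp: abs_mult intro!: mult_right_mono bd)
    qed (use g in auto)
    moreover have "(LINT t|lborel. (\<Sum>i\<le>N j. c j i * exp (- t) ^ i) * g t) = 0" for j
    proof -
      have "(LINT t|lborel. (\<Sum>i\<le>N j. c j i * exp (- t) ^ i) * g t) = (LINT t|lborel. (\<Sum>i\<le>N j. c j i * (exp (- t) ^ i * g t)))"
        by (simp add: sum_distrib_right mult.assoc)
      also have "\<dots> = (\<Sum>i\<le>N j. LINT t|lborel. c j i * (exp (- t) ^ i * g t))"
        by (intro Bochner_Integration.integral_sum) (auto intro!: int)
      finally show ?thesis by (simp add: zero')
    qed
    ultimately have *: "(LINT t|lborel. indicator {..x} t * g t) = 0"
      by (simp add: LIMSEQ_const_iff)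
    \<comment> \<open>The passage to the complementary half-line uses the node \<open>n = 0\<close>,
      that is, the vanishing of the total integral.\<close>
    have "(LINT t|lborel. indicator {x<..} t * g t) = (LINT t|lborel. g t - indicator {..x} t * g t)"
      by (intro Bochner_Integration.integral_cong) (auto split: split_indicator)
    also have "\<dots> = (LINT t|lborel. g t) - (LINT t|lborel. indicator {..x} t * g t)"
      using g by (intro Bochner_Integration.integral_diff) (auto intro!: integrable_real_mult_indicator simp: mult.commute)
    finally show ?thesis using * zero'[of 0] by simp
  qed
  from integral_zero_on_rays_imp_AE_zero[OF g this] show ?thesis
    by eventually_elim (auto simp: g_def)
qed

section \<open>The Laplace transform of the moments\<close>

lemma subordinator_laws_AE_nonneg:
  assumes "subordinator_laws k \<mu>" "s \<ge> 0"
  shows "AE \<tau> in \<mu> s. 0 \<le> \<tau>"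
proof (rule AE_I[of _ _ "{..<0}"])
  show "{..<0} \<in> sets (\<mu> s)" "emeasure (\<mu> s) {..<0} = 0"
    using assms by (auto simp: subordinator_laws_def)
qed auto

text \<open>Measurability in s is forced by the transforms: the mass of \<open>{..b}\<close> is a
  limit of linear combinations of \<open>exp (- s * lapL k i)\<close>, each continuous in s, and the
  sets \<open>{..b}\<close> generate the Borel sets. Since the laws are prescribed only for
  nonnegative s, \<open>max 0 s\<close> makes the family total.\<close>

lemma subordinator_laws_kernel:
  assumes \<mu>: "subordinator_laws k \<mu>"
  shows "(\<lambda>s. \<mu> (max 0 s)) \<in> borel \<rightarrow>\<^sub>M prob_algebra borel"
proof (rule measurable_prob_algebra_generated[where G = "range (\<lambda>b::real. {..b})" and \<Omega> = UNIV])
  show "sets borel = sigma_sets UNIV (range (\<lambda>b::real. {..b}))"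
    by (subst borel_eq_atMost) simp
  show "Int_stable (range (\<lambda>b::real. {..b}))"
    by (auto simp: Int_stable_def)
  have prob: "prob_space (\<mu> (max 0 s))" and sets: "sets (\<mu> (max 0 s)) = sets borel" for s
    using \<mu> by (auto simp: subordinator_laws_def)
  then show "prob_space (\<mu> (max 0 s))" "sets (\<mu> (max 0 s)) = sets borel" for s by auto
  fix A assume "A \<in> range (\<lambda>b::real. {..b})"
  then obtain b where A: "A = {..b}" by auto
  obtain N :: "nat \<Rightarrow> nat" and c :: "nat \<Rightarrow> nat \<Rightarrow> real" where
    Nc: "\<forall>y\<in>{0..1}. (\<forall>j. \<bar>\<Sum>i\<le>N j. c j i * y ^ i\<bar> \<le> 2) \<and>
        (\<lambda>j. \<Sum>i\<le>N j. c j i * y ^ i) \<longlonglongrightarrow> indicator {exp (- b)..} y"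
    using step_function_polynomial_approx[of "exp (- b)"] by (elim exE)
  have "(\<lambda>j. \<Sum>i\<le>N j. c j i * exp (- max 0 s * lapL k (real i))) \<longlonglongrightarrow> measure (\<mu> (max 0 s)) {..b}" for s
  proof -
    let ?M = "\<mu> (max 0 s)"
    interpret prob_space ?M by (rule prob)
    have [measurable_cong]: "sets ?M = sets borel" by (rule sets)
    have nonneg: "AE \<tau> in ?M. 0 \<le> \<tau>"
      using \<mu> by (rule subordinator_laws_AE_nonneg) simp
    have int: "integrable ?M (\<lambda>\<tau>. exp (- \<tau>) ^ i)" for i
    proof (rule integrable_const_bound[where B = 1])
      show "AE \<tau> in ?M. norm (exp (- \<tau>) ^ i) \<le> 1"
        using nonneg by eventually_elim (simp add: power_le_one)
    qed simp
    \<comment> \<open>The hypothesis on the laws covers only positive arguments. At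
      \<open>i = 0\<close> the factor p in \<open>lapL\<close> makes the right-hand side 1, which is
      the total mass.\<close>
    have lap: "(\<integral>\<tau>. exp (- \<tau>) ^ i \<partial>?M) = exp (- max 0 s * lapL k (real i))" for i
    proof (cases "i = 0")
      case True
      then show ?thesis by (simp add: lapL_def prob_space)
    next
      case False
      then have "(\<integral>\<tau>. exp (- real i * \<tau>) \<partial>?M) = exp (- max 0 s * lapL k (real i))"
        using \<mu> by (auto simp: subordinator_laws_def)
      then show ?thesis by (simp flip: exp_of_nat_mult)
    qed
    have "(\<lambda>j. \<integral>\<tau>. (\<Sum>i\<le>N j. c j i * exp (- \<tau>) ^ i) \<partial>?M) \<longlonglongrightarrow> (\<integral>\<tau>. indicator {..b} \<tau> \<partial>?M)"
    proof (rule integral_dominated_convergence[where w = "\<lambda>_. 2"])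
      show "AE \<tau> in ?M. (\<lambda>j. \<Sum>i\<le>N j. c j i * exp (- \<tau>) ^ i) \<longlonglongrightarrow> indicator {..b} \<tau>"
        using nonneg
      proof eventually_elim
        case (elim \<tau>)
        have "indicator {exp (- b)..} (exp (- \<tau>)) = (indicator {..b} \<tau> :: real)"
          by (auto simp: indicator_def)
        then show ?case using Nc[THEN bspec, of "exp (- \<tau>)"] elim by simp
      qed
      show "AE \<tau> in ?M. norm (\<Sum>i\<le>N j. c j i * exp (- \<tau>) ^ i) \<le> 2" for j
        using nonneg by eventually_elim (use Nc in simp)
    qed auto
    moreover have "(\<integral>\<tau>. (\<Sum>i\<le>N j. c j i * exp (- \<tau>) ^ i) \<partial>?M) =
        (\<Sum>i\<le>N j. c j i * exp (- max 0 s * lapL k (real i)))" for j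
      using int by (simp add: lap)
    ultimately show ?thesis by simp
  qed
  then have "(\<lambda>s. measure (\<mu> (max 0 s)) {..b}) \<in> borel_measurable borel"
    by (rule borel_measurable_LIMSEQ_real) measurable
  moreover have "emeasure (\<mu> (max 0 s)) {..b} = ennreal (measure (\<mu> (max 0 s)) {..b})" for s
  proof -
    interpret prob_space "\<mu> (max 0 s)" by (rule prob)
    show ?thesis by (rule emeasure_eq_measure)
  qed
  ultimately show "(\<lambda>s. emeasure (\<mu> (max 0 s)) A) \<in> borel_measurable borel"
    unfolding A by simp
qed auto

text \<open>Nothing is known about \<open>k\<close> on the negative reals. Cutting it off there
  turns \<open>subG\<close> into a convolution whose domain of integration does not move with t. The
  point 0 is kept because the range \<open>{0..t}\<close> in \<open>subG\<close> includes the
  endpoint where \<open>k 0\<close> is evaluated.\<close>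

definition zero_extension :: "(real \<Rightarrow> real) \<Rightarrow> real \<Rightarrow> real" where
  "zero_extension k u = indicator {0..} u * k u"

lemma zero_extension_measurable:
  assumes "standing_kernel k"
  shows "zero_extension k \<in> borel_measurable borel"
proof -
  have "set_integrable lborel {0<..} (\<lambda>t. exp (- 1 * t) * k t)"
    using assms unfolding standing_kernel_def by (meson zero_less_one)
  then have "(\<lambda>t. indicator {0<..} t * (exp (- t) * k t)) \<in> borel_measurable borel"
    by (auto simp: set_integrable_def)
  then have m: "(\<lambda>t. exp t * (indicator {0<..} t * (exp (- t) * k t))) \<in> borel_measurable borel"
    by measurable
  have "zero_extension k = (\<lambda>t. exp t * (indicator {0<..} t * (exp (- t) * k t)) + indicator {0} t * k 0)"
    by (auto simp: zero_extension_def fun_eq_iff indicator_def exp_minus)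
  also have "\<dots> \<in> borel_measurable borel"
    using m by measurable
  finally show ?thesis .
qed

lemma subG_zero_extension:
  "subG k \<mu> s t = (\<integral>\<^sup>+ \<tau>. ennreal (zero_extension k (t - \<tau>)) * indicator {0..} \<tau> \<partial>\<mu> s)"
  unfolding subG_def zero_extension_def
  by (intro nn_integral_cong) (auto simp: indicator_def)

lemma subG_measurable:
  assumes "standing_kernel k" and \<mu>: "subordinator_laws k \<mu>"
  shows "(\<lambda>(s, t). subG k \<mu> (max 0 s) t) \<in> borel_measurable (borel \<Otimes>\<^sub>M borel)"
proof -
  note zero_extension_measurable[OF assms(1), measurable]
  have "(\<lambda>s. \<mu> (max 0 s)) \<in> borel \<rightarrow>\<^sub>M subprob_algebra borel"
    using subordinator_laws_kernel[OF \<mu>] by (rule measurable_prob_algebraD)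
  then have "(\<lambda>z. \<mu> (max 0 (fst z))) \<in> borel \<Otimes>\<^sub>M (borel :: real measure) \<rightarrow>\<^sub>M subprob_algebra borel"
    by (rule measurable_compose[OF measurable_fst])
  then have "(\<lambda>z. \<integral>\<^sup>+ \<tau>. ennreal (zero_extension k (snd z - \<tau>)) * indicator {0..} \<tau> \<partial>\<mu> (max 0 (fst z)))
      \<in> borel_measurable (borel \<Otimes>\<^sub>M borel)"
    by (rule nn_integral_measurable_subprob_algebra2[rotated]) measurable
  then show ?thesis
    by (simp add: subG_zero_extension case_prod_beta)
qed

section \<open>Laplace transforms of the kernel and of the moments\<close>

lemma lapK_nn_integral:
  assumes "standing_kernel k" "p > 0"
  shows "(\<integral>\<^sup>+ u. ennreal (exp (- p * u)) * ennreal (zero_extension k u) \<partial>lborel) = ennreal (lapK k p)"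
proof -
  have k: "\<And>t. t > 0 \<Longrightarrow> k t \<ge> 0"
    and int: "integrable lborel (\<lambda>t. indicator {0<..} t * (exp (- p * t) * k t))"
    using assms by (auto simp: standing_kernel_def set_integrable_def)
  have "(\<integral>\<^sup>+ u. ennreal (exp (- p * u)) * ennreal (zero_extension k u) \<partial>lborel) =
      (\<integral>\<^sup>+ u. ennreal (indicator {0<..} u * (exp (- p * u) * k u)) \<partial>lborel)"
  proof (rule nn_integral_cong_AE)
    show "AE u in lborel. ennreal (exp (- p * u)) * ennreal (zero_extension k u) =
        ennreal (indicator {0<..} u * (exp (- p * u) * k u))"
      using AE_lborel_singleton[of 0]
      by eventually_elim (auto simp: zero_extension_def indicator_def ennreal_mult')
  qed
  also have "\<dots> = ennreal (LINT u|lborel. indicator {0<..} u * (exp (- p * u) * k u))"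
    by (rule nn_integral_eq_integral[OF int]) (auto simp: indicator_def k)
  finally show ?thesis
    by (simp add: lapK_def set_lebesgue_integral_def)
qed

text \<open>The convolution theorem: as a function of t the kernel is the convolution of
  \<open>k\<close> with the law \<open>\<mu> s\<close>, so the transforms multiply. Everything is
  nonnegative, and Tonelli needs no finiteness.\<close>

lemma subG_laplace:
  assumes k: "standing_kernel k" and \<mu>: "subordinator_laws k \<mu>" and "p > 0" "s \<ge> 0"
  shows "(\<integral>\<^sup>+ t. ennreal (exp (- p * t)) * subG k \<mu> s t * indicator {0<..} t \<partial>lborel) =
    ennreal (lapK k p) * ennreal (exp (- s * lapL k p))"
proof -
  note zero_extension_measurable[OF k, measurable]
  interpret prob_space "\<mu> s" using \<mu> \<open>s \<ge> 0\<close> by (auto simp: subordinator_laws_def)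
  have [measurable_cong]: "sets (\<mu> s) = sets borel"
    using \<mu> \<open>s \<ge> 0\<close> by (auto simp: subordinator_laws_def)
  interpret pair_sigma_finite "\<mu> s" "lborel :: real measure" ..
  let ?f = "\<lambda>\<tau> t. ennreal (exp (- p * t)) * (ennreal (zero_extension k (t - \<tau>)) * indicator {0..} \<tau>) * indicator {0<..} t"
  have "(\<integral>\<^sup>+ t. ennreal (exp (- p * t)) * subG k \<mu> s t * indicator {0<..} t \<partial>lborel) =
      (\<integral>\<^sup>+ t. \<integral>\<^sup>+ \<tau>. ?f \<tau> t \<partial>\<mu> s \<partial>lborel)"
    unfolding subG_zero_extension
    by (intro nn_integral_cong) (simp add: nn_integral_cmult nn_integral_multc)
  also have "\<dots> = (\<integral>\<^sup>+ \<tau>. \<integral>\<^sup>+ t. ?f \<tau> t \<partial>lborel \<partial>\<mu> s)"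
    by (rule Fubini') measurable
  also have "\<dots> = (\<integral>\<^sup>+ \<tau>. ennreal (exp (- p * \<tau>)) * ennreal (lapK k p) \<partial>\<mu> s)"
  proof (rule nn_integral_cong_AE)
    show "AE \<tau> in \<mu> s. (\<integral>\<^sup>+ t. ?f \<tau> t \<partial>lborel) = ennreal (exp (- p * \<tau>)) * ennreal (lapK k p)"
      using subordinator_laws_AE_nonneg[OF \<mu> \<open>s \<ge> 0\<close>]
    proof eventually_elim
      case (elim \<tau>)
      have "(\<integral>\<^sup>+ t. ?f \<tau> t \<partial>lborel) = (\<integral>\<^sup>+ t. ennreal (exp (- p * t)) * ennreal (zero_extension k (t - \<tau>)) \<partial>lborel)"
      proof (rule nn_integral_cong_AE)
        show "AE t in lborel. ?f \<tau> t = ennreal (exp (- p * t)) * ennreal (zero_extension k (t - \<tau>))"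
          using AE_lborel_singleton[of \<tau>]
          by eventually_elim (use elim in \<open>auto simp: zero_extension_def indicator_def\<close>)
      qed
      also have "\<dots> = (\<integral>\<^sup>+ u. ennreal (exp (- p * (\<tau> + 1 * u))) * ennreal (zero_extension k (\<tau> + 1 * u - \<tau>)) \<partial>lborel)"
        by (subst nn_integral_real_affine[where c = 1 and t = \<tau>]) auto
      also have "\<dots> = (\<integral>\<^sup>+ u. ennreal (exp (- p * \<tau>)) * (ennreal (exp (- p * u)) * ennreal (zero_extension k u)) \<partial>lborel)"
      proof (rule nn_integral_cong)
        fix u :: real
        have "exp (- p * (\<tau> + 1 * u)) = exp (- p * \<tau>) * exp (- p * u)"
          by (simp add: exp_add[symmetric] algebra_simps)
        then show "ennreal (exp (- p * (\<tau> + 1 * u))) * ennreal (zero_extension k (\<tau> + 1 * u - \<tau>)) =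
            ennreal (exp (- p * \<tau>)) * (ennreal (exp (- p * u)) * ennreal (zero_extension k u))"
          by (simp add: ennreal_mult' mult.assoc)
      qed
      also have "\<dots> = ennreal (exp (- p * \<tau>)) * ennreal (lapK k p)"
        by (simp add: nn_integral_cmult lapK_nn_integral[OF k \<open>p > 0\<close>, simplified])
      finally show ?case .
    qed
  qed
  also have "\<dots> = (\<integral>\<^sup>+ \<tau>. ennreal (exp (- p * \<tau>)) \<partial>\<mu> s) * ennreal (lapK k p)"
    by (rule nn_integral_multc) measurable
  also have "(\<integral>\<^sup>+ \<tau>. ennreal (exp (- p * \<tau>)) \<partial>\<mu> s) = ennreal (\<integral> \<tau>. exp (- p * \<tau>) \<partial>\<mu> s)"
  proof (rule nn_integral_eq_integral)
    show "integrable (\<mu> s) (\<lambda>\<tau>. exp (- p * \<tau>))"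
    proof (rule integrable_const_bound[where B = 1])
      show "AE \<tau> in \<mu> s. norm (exp (- p * \<tau>)) \<le> 1"
        using subordinator_laws_AE_nonneg[OF \<mu> \<open>s \<ge> 0\<close>] by eventually_elim (use \<open>p > 0\<close> in simp)
    qed simp
  qed simp
  also have "(\<integral> \<tau>. exp (- p * \<tau>) \<partial>\<mu> s) = exp (- s * lapL k p)"
    using \<mu> assms by (auto simp: subordinator_laws_def)
  finally show ?thesis by (simp add: mult.commute)
qed

lemma kappa_measurable:
  assumes "standing_kernel k" "subordinator_laws k \<mu>"
  shows "kappa k \<mu> \<beta> n \<in> borel_measurable borel"
proof -
  note subG_measurable[OF assms, measurable]
  have eq: "kappa k \<mu> \<beta> n = (\<lambda>t. \<integral>\<^sup>+ s. subG k \<mu> (max 0 s) t * ennreal (exp (real n * \<beta> * s)) * indicator {0<..} s \<partial>lborel)"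
    unfolding kappa_def by (intro ext nn_integral_cong) (auto simp: indicator_def max_def)
  show ?thesis unfolding eq by measurable
qed

lemma nn_integral_exp_Ioi:
  assumes "b > (0::real)"
  shows "(\<integral>\<^sup>+ s. ennreal (exp (- b * s)) * indicator {0<..} s \<partial>lborel) = ennreal (1 / b)"
proof -
  have "(\<integral>\<^sup>+ s. ennreal (exp (- b * s)) * indicator {0<..} s \<partial>lborel) =
      (\<integral>\<^sup>+ s. ennreal (exp (- b * s)) * indicator {0..} s \<partial>lborel)"
    by (intro nn_integral_cong_AE, rule eventually_mono[OF AE_lborel_singleton[of 0]])
       (auto simp: indicator_def)
  also have "\<dots> = ennreal (0 - (- exp (- b * 0) / b))"
  proof (rule nn_integral_FTC_atLeast)
    show "((\<lambda>x. - exp (- b * x) / b) \<longlongrightarrow> 0) at_top"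
      using assms by real_asymp
  qed (use assms in \<open>auto intro!: derivative_eq_intros\<close>)
  finally show ?thesis by simp
qed

text \<open>After Tonelli the integral over s is that of \<open>exp (- (L - a) s)\<close>, times K;
  the condition \<open>L > a\<close> is what makes it converge.\<close>

lemma kappa_laplace:
  assumes k: "standing_kernel k" and \<mu>: "subordinator_laws k \<mu>"
    and p: "p > 0" "lapL k p > real n * \<beta>"
  shows "(\<integral>\<^sup>+ t. ennreal (exp (- p * t)) * kappa k \<mu> \<beta> n t * indicator {0<..} t \<partial>lborel) =
    ennreal (lapK k p / (lapL k p - real n * \<beta>))"
proof -
  note subG_measurable[OF k \<mu>, measurable]
  let ?a = "real n * \<beta>"
  let ?f = "\<lambda>s t. ennreal (exp (- p * t)) * (subG k \<mu> (max 0 s) t * ennreal (exp (?a * s)) * indicator {0<..} s) * indicator {0<..} t"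
  have "(\<integral>\<^sup>+ t. ennreal (exp (- p * t)) * kappa k \<mu> \<beta> n t * indicator {0<..} t \<partial>lborel) =
     (\<integral>\<^sup>+ t. \<integral>\<^sup>+ s. ?f s t \<partial>lborel \<partial>lborel)"
  proof (rule nn_integral_cong)
    fix t :: real
    have "kappa k \<mu> \<beta> n t = (\<integral>\<^sup>+ s. subG k \<mu> (max 0 s) t * ennreal (exp (?a * s)) * indicator {0<..} s \<partial>lborel)"
      unfolding kappa_def by (intro nn_integral_cong) (auto simp: indicator_def max_def)
    then show "ennreal (exp (- p * t)) * kappa k \<mu> \<beta> n t * indicator {0<..} t = (\<integral>\<^sup>+ s. ?f s t \<partial>lborel)"
      by (simp add: nn_integral_cmult nn_integral_multc)
  qed
  also have "\<dots> = (\<integral>\<^sup>+ s. \<integral>\<^sup>+ t. ?f s t \<partial>lborel \<partial>lborel)"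
    by (rule lborel_pair.Fubini') measurable
  also have "\<dots> = (\<integral>\<^sup>+ s. ennreal (lapK k p) * (ennreal (exp (- (lapL k p - ?a) * s)) * indicator {0<..} s) \<partial>lborel)"
  proof (rule nn_integral_cong)
    fix s :: real
    have "(\<integral>\<^sup>+ t. ?f s t \<partial>lborel) =
        (\<integral>\<^sup>+ t. (ennreal (exp (?a * s)) * indicator {0<..} s) *
          (ennreal (exp (- p * t)) * subG k \<mu> (max 0 s) t * indicator {0<..} t) \<partial>lborel)"
      by (intro nn_integral_cong) (simp add: mult_ac)
    also have "\<dots> = (ennreal (exp (?a * s)) * indicator {0<..} s) * (ennreal (lapK k p) * ennreal (exp (- max 0 s * lapL k p)))"
      by (subst nn_integral_cmult) (simp_all only: subG_laplace[OF k \<mu> \<open>p > 0\<close>] max.cobounded1, measurable)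
    also have "\<dots> = ennreal (lapK k p) * (ennreal (exp (- (lapL k p - ?a) * s)) * indicator {0<..} s)"
    proof (cases "s > 0")
      case True
      have "ennreal (exp (- (lapL k p - ?a) * s)) = ennreal (exp (?a * s)) * ennreal (exp (- s * lapL k p))"
        by (simp add: ennreal_mult'[symmetric] exp_add[symmetric] algebra_simps)
      with True show ?thesis by (simp add: mult_ac)
    qed simp
    finally show "(\<integral>\<^sup>+ t. ?f s t \<partial>lborel) = ennreal (lapK k p) * (ennreal (exp (- (lapL k p - ?a) * s)) * indicator {0<..} s)" .
  qed
  also have "\<dots> = ennreal (lapK k p) * ennreal (1 / (lapL k p - ?a))"
    using p(2) by (subst nn_integral_cmult) (simp_all only: nn_integral_exp_Ioi diff_gt_0_iff_gt, measurable)
  also have "\<dots> = ennreal (lapK k p / (lapL k p - ?a))"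
    using p(2) by (subst ennreal_mult''[symmetric]) simp_all
  finally show ?thesis .
qed

section \<open>Stieltjes transforms on the slit plane\<close>

text \<open>The only integrable weight at hand is \<open>1 / (1 + t)\<close>, so every integrand has
  to be compared with it. For \<open>t \<ge> 2 |z| + 1\<close> one has
  \<open>t - |z| \<ge> (1 + t) / 2\<close>; on the remaining compact range \<open>|z + t|\<close>
  has a positive minimum, because z avoids the cut.\<close>

lemma slit_plane_norm_ge:
  fixes z :: complex
  assumes "z \<notin> \<real>\<^sub>\<le>\<^sub>0"
  obtains \<delta> where "\<delta> > 0" "\<And>t. t \<ge> 0 \<Longrightarrow> \<delta> * (1 + t) \<le> norm (z + of_real t)"
proof -
  define T where "T = 2 * norm z + 1"
  have T: "T \<ge> 1" by (simp add: T_def)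
  have "continuous_on {0..T} (\<lambda>t. norm (z + of_real t))"
    by (intro continuous_intros)
  then obtain t0 where t0: "t0 \<in> {0..T}" "\<And>t. t \<in> {0..T} \<Longrightarrow> norm (z + of_real t0) \<le> norm (z + of_real t)"
    using continuous_attains_inf[of "{0..T}" "\<lambda>t. norm (z + of_real t)"] T by auto
  define m where "m = norm (z + of_real t0)"
  have "z + of_real t0 \<noteq> 0"
  proof
    assume "z + of_real t0 = 0"
    then have "z = of_real (- t0)" by (simp add: add_eq_0_iff2)
    then show False using assms t0(1) by (simp add: complex_nonpos_Reals_iff)
  qed
  then have m: "m > 0" by (simp add: m_def)
  show thesis
  proof (rule that[of "min (1/2) (m / (1 + T))"])
    show "min (1/2) (m / (1 + T)) > 0" using m T by simp
    fix t :: real assume t: "t \<ge> 0"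
    show "min (1/2) (m / (1 + T)) * (1 + t) \<le> norm (z + of_real t)"
    proof (cases "t \<le> T")
      case True
      have "min (1/2) (m / (1 + T)) * (1 + t) \<le> m / (1 + T) * (1 + T)"
        using t True m T by (intro mult_mono) auto
      also have "\<dots> \<le> norm (z + of_real t)"
        using t0(2)[of t] t True T by (simp add: m_def)
      finally show ?thesis .
    next
      case False
      have "min (1/2) (m / (1 + T)) * (1 + t) \<le> 1/2 * (1 + t)"
 by (rule mult_right_mono[OF min.cobounded1]) (use t in simp)
      also have "\<dots> \<le> t - norm z" using False by (simp add: T_def)
      also have "\<dots> \<le> norm (z + of_real t)"
        using norm_diff_ineq[of "of_real t" z] t by (simp add: add.commute)
      finally show ?thesis .
    qed
  qed
qed

context
  fixes \<sigma> :: "real measure"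
  assumes sets_eq [measurable_cong]: "sets \<sigma> = sets borel"
    and null_neg: "emeasure \<sigma> {..<0} = 0"
    and finite_weight: "(\<integral>\<^sup>+ t. ennreal (1 / (1 + t)) \<partial>\<sigma>) < \<infinity>"
begin

lemma stieltjes_AE_nonneg: "AE t in \<sigma>. 0 \<le> t"
  by (rule AE_I[of _ _ "{..<0}"]) (use null_neg sets_eq in auto)

lemma stieltjes_weight_integrable: "integrable \<sigma> (\<lambda>t. 1 / (1 + t))"
proof (rule integrableI_bounded)
  have "(\<integral>\<^sup>+ t. ennreal (norm (1 / (1 + t))) \<partial>\<sigma>) = (\<integral>\<^sup>+ t. ennreal (1 / (1 + t)) \<partial>\<sigma>)"
    by (rule nn_integral_cong_AE) (use stieltjes_AE_nonneg in \<open>eventually_elim, simp\<close>)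
  with finite_weight show "(\<integral>\<^sup>+ t. ennreal (norm (1 / (1 + t))) \<partial>\<sigma>) < \<infinity>" by simp
qed measurable

lemma stieltjes_integrable_bound:
  fixes f :: "real \<Rightarrow> 'a :: {banach, second_countable_topology}"
  assumes "f \<in> borel_measurable \<sigma>" "\<And>t. t \<ge> 0 \<Longrightarrow> norm (f t) \<le> c / (1 + t)"
  shows "integrable \<sigma> f"
proof (rule Bochner_Integration.integrable_bound)
  show "integrable \<sigma> (\<lambda>t. c * (1 / (1 + t)))"
    using stieltjes_weight_integrable by (rule integrable_mult_right)
  show "AE t in \<sigma>. norm (f t) \<le> norm (c * (1 / (1 + t)))"
    using stieltjes_AE_nonneg
  proof eventually_elim
    case (elim t)
    have "norm (f t) \<le> c / (1 + t)" using assms(2) elim by simp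
    also have "\<dots> \<le> norm (c * (1 / (1 + t)))" using elim by (simp add: divide_right_mono)
    finally show ?case .
  qed
qed (fact assms(1))

text \<open>The bounded weight \<open>g\<close> lets one argument serve two integrals:
  \<open>g = 1\<close> gives the Stieltjes transform itself, and \<open>g t = t / (p + t)\<close>
  gives the difference quotient of L at p.\<close>

lemma stieltjes_transform_integrable:
  fixes g :: "real \<Rightarrow> real"
  assumes [measurable]: "g \<in> borel_measurable borel" and g: "\<And>t. t \<ge> 0 \<Longrightarrow> \<bar>g t\<bar> \<le> 1" and z: "z \<notin> \<real>\<^sub>\<le>\<^sub>0"
  shows "integrable \<sigma> (\<lambda>t. of_real (g t) / (z + of_real t) :: complex)"
proof -
  obtain \<delta> where \<delta>: "\<delta> > 0" "\<And>t. t \<ge> 0 \<Longrightarrow> \<delta> * (1 + t) \<le> norm (z + of_real t)"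
    using slit_plane_norm_ge[OF z] by metis
  show ?thesis
  proof (rule stieltjes_integrable_bound)
    fix t :: real assume t: "t \<ge> 0"
    have "norm (of_real (g t) / (z + of_real t)) \<le> 1 / (\<delta> * (1 + t))"
      unfolding norm_divide using \<delta>(1) \<delta>(2)[OF t] g[OF t] t by (intro frac_le) auto
    then show "norm (of_real (g t) / (z + of_real t)) \<le> (1 / \<delta>) / (1 + t)" by simp
  qed measurable
qed

text \<open>Differentiation under the integral with an explicit remainder: the difference quotient
  minus the candidate derivative equals (w - z) times the integral of
  \<open>g / ((w + t) (z + t)^2)\<close>. On the ball of radius \<open>\<delta> / 2\<close> the
  bound on \<open>|z + t|\<close> loses at most a factor 2 when z is replaced by w, because
  \<open>1 + t \<ge> 1\<close>; so the remainder integral stays bounded as w tends to z.\<close>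

lemma stieltjes_transform_holomorphic:
  fixes g :: "real \<Rightarrow> real"
  assumes [measurable]: "g \<in> borel_measurable borel" and g: "\<And>t. t \<ge> 0 \<Longrightarrow> \<bar>g t\<bar> \<le> 1"
  shows "(\<lambda>z. CLINT t|\<sigma>. of_real (g t) / (z + of_real t)) holomorphic_on - \<real>\<^sub>\<le>\<^sub>0"
proof (rule holomorphic_onI)
  fix z :: complex assume "z \<in> - \<real>\<^sub>\<le>\<^sub>0"
  then have z: "z \<notin> \<real>\<^sub>\<le>\<^sub>0" by simp
  let ?f = "\<lambda>z. CLINT t|\<sigma>. of_real (g t) / (z + of_real t)"
  obtain \<delta> where \<delta>: "\<delta> > 0" "\<And>t. t \<ge> 0 \<Longrightarrow> \<delta> * (1 + t) \<le> norm (z + of_real t)"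
    using slit_plane_norm_ge[OF z] by metis
  have nz: "z + of_real t \<noteq> 0" if "t \<ge> 0" for t
    using \<delta>(2)[OF that] \<delta>(1) that by (smt (verit) mult_pos_pos norm_zero)
  define D where "D = (\<integral>t. - (of_real (g t) / (z + of_real t)\<^sup>2) \<partial>\<sigma>)"
  have iD: "integrable \<sigma> (\<lambda>t. - (of_real (g t) / (z + of_real t)\<^sup>2))"
  proof (rule stieltjes_integrable_bound)
    fix t :: real assume t: "t \<ge> 0"
    have "(\<delta>\<^sup>2 * (1 + t)) * 1 \<le> (\<delta>\<^sup>2 * (1 + t)) * (1 + t)"
      using \<delta>(1) t by (intro mult_left_mono) auto
    also have "\<dots> = (\<delta> * (1 + t))\<^sup>2"
      by (simp add: power2_eq_square)
    also have "\<dots> \<le> (norm (z + of_real t))\<^sup>2"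
      using \<delta>(1) \<delta>(2)[OF t] t by (intro power_mono) auto
    finally have "norm (- (of_real (g t) / (z + of_real t)\<^sup>2)) \<le> 1 / (\<delta>\<^sup>2 * (1 + t))"
      unfolding norm_minus_cancel norm_divide norm_power using \<delta>(1) g[OF t] t by (intro frac_le) auto
    then show "norm (- (of_real (g t) / (z + of_real t)\<^sup>2)) \<le> (1 / \<delta>\<^sup>2) / (1 + t)" by simp
  qed measurable
  define C where "C = (\<integral>t. 1 / (1 + t) \<partial>\<sigma>)"
  have bound: "norm ((?f w - ?f z) / (w - z) - D) \<le> norm (w - z) * (2 / \<delta> ^ 3 * C)"
    if w: "w \<in> ball z (\<delta> / 2)" "w \<noteq> z" for w
  proof -
    have wt: "\<delta> / 2 * (1 + t) \<le> norm (w + of_real t)" if t: "t \<ge> 0" for t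
    proof -
      have "norm (z + of_real t) \<le> norm (w + of_real t) + norm (z - w)"
        using norm_triangle_ineq[of "w + of_real t" "z - w"] by (simp add: algebra_simps)
      moreover have "norm (z - w) < \<delta> / 2" using w by (simp add: dist_norm)
      moreover have "\<delta> / 2 \<le> \<delta> / 2 * (1 + t)" using \<delta>(1) t by simp
      moreover have "\<delta> * (1 + t) = \<delta> / 2 * (1 + t) + \<delta> / 2 * (1 + t)" by simp
      ultimately show ?thesis using \<delta>(2)[OF t] by linarith
    qed
    have wnz: "w + of_real t \<noteq> 0" if "t \<ge> 0" for t
      using wt[OF that] \<delta>(1) that by (smt (verit) half_gt_zero mult_pos_pos norm_zero)
    have "w \<notin> \<real>\<^sub>\<le>\<^sub>0"
    proof
      assume "w \<in> \<real>\<^sub>\<le>\<^sub>0"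
      then have "w + of_real (- Re w) = 0" "- Re w \<ge> 0"
        by (auto simp: complex_nonpos_Reals_iff complex_eq_iff)
      then show False using wnz by blast
    qed
    then have iw: "integrable \<sigma> (\<lambda>t. of_real (g t) / (w + of_real t))"
      using g by (intro stieltjes_transform_integrable) auto
    have iz: "integrable \<sigma> (\<lambda>t. of_real (g t) / (z + of_real t))"
      using g z by (intro stieltjes_transform_integrable) auto
    have "(?f w - ?f z) / (w - z) - D =
        (\<integral>t. (of_real (g t) / (w + of_real t) - of_real (g t) / (z + of_real t)) / (w - z)
           - (- (of_real (g t) / (z + of_real t)\<^sup>2)) \<partial>\<sigma>)"
      unfolding D_def using iw iz iD by simp
    also have "norm \<dots> \<le> (\<integral>t. norm (w - z) * (2 / \<delta> ^ 3) * (1 / (1 + t)) \<partial>\<sigma>)"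
    proof (rule order_trans[OF integral_norm_bound integral_mono_AE])
      show "integrable \<sigma> (\<lambda>t. norm ((of_real (g t) / (w + of_real t) - of_real (g t) / (z + of_real t)) / (w - z)
           - (- (of_real (g t) / (z + of_real t)\<^sup>2))))"
        using iw iz iD by simp
      show "integrable \<sigma> (\<lambda>t. norm (w - z) * (2 / \<delta> ^ 3) * (1 / (1 + t)))"
        using stieltjes_weight_integrable by (rule integrable_mult_right)
      show "AE t in \<sigma>. norm ((of_real (g t) / (w + of_real t) - of_real (g t) / (z + of_real t)) / (w - z)
           - (- (of_real (g t) / (z + of_real t)\<^sup>2))) \<le> norm (w - z) * (2 / \<delta> ^ 3) * (1 / (1 + t))"
        using stieltjes_AE_nonneg
      proof eventually_elim
        case (elim t)
        have "(of_real (g t) / (w + of_real t) - of_real (g t) / (z + of_real t)) / (w - z)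
           - (- (of_real (g t) / (z + of_real t)\<^sup>2)) = (w - z) * (of_real (g t) / ((w + of_real t) * (z + of_real t)\<^sup>2))"
          using nz[OF elim] wnz[OF elim] w(2) by (simp add: divide_simps power2_eq_square) (simp add: algebra_simps)
        moreover have "norm (of_real (g t) / ((w + of_real t) * (z + of_real t)\<^sup>2)) \<le> 2 / \<delta> ^ 3 * (1 / (1 + t))"
        proof -
          have "\<delta> ^ 3 / 2 * (1 + t) * 1 \<le> \<delta> ^ 3 / 2 * (1 + t) * (1 + t)\<^sup>2"
            using \<delta>(1) elim by (intro mult_left_mono) (auto simp: one_le_power)
          also have "\<dots> = (\<delta> / 2 * (1 + t)) * (\<delta> * (1 + t))\<^sup>2"
            by (simp add: power2_eq_square power3_eq_cube)
          also have "\<dots> \<le> norm (w + of_real t) * (norm (z + of_real t))\<^sup>2"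
            using wt[OF elim] \<delta>(2)[OF elim] \<delta>(1) elim by (intro mult_mono power_mono) auto
          finally have *: "\<delta> ^ 3 / 2 * (1 + t) \<le> norm (w + of_real t) * (norm (z + of_real t))\<^sup>2" by simp
          have "norm (of_real (g t) / ((w + of_real t) * (z + of_real t)\<^sup>2)) \<le> 1 / (\<delta> ^ 3 / 2 * (1 + t))"
            unfolding norm_divide norm_mult norm_power using * g[OF elim] elim \<delta>(1) by (intro frac_le) auto
          then show ?thesis by simp
        qed
        ultimately show ?case
          by (simp add: norm_mult mult_left_mono mult.assoc del: times_divide_eq_right)
      qed
    qed
    also have "\<dots> = norm (w - z) * (2 / \<delta> ^ 3 * C)"
      unfolding C_def by (simp only: integral_mult_right_zero mult.assoc)
    finally show ?thesis .
  qed
  have "(?f has_field_derivative D) (at z)"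
    unfolding has_field_derivative_iff
  proof (rule LIM_zero_cancel, rule Lim_null_comparison)
    show "\<forall>\<^sub>F w in at z. norm ((?f w - ?f z) / (w - z) - D) \<le> norm (w - z) * (2 / \<delta> ^ 3 * C)"
      unfolding eventually_at_topological using bound \<delta>(1)
      by (intro exI[of _ "ball z (\<delta> / 2)"]) auto
    show "((\<lambda>w. norm (w - z) * (2 / \<delta> ^ 3 * C)) \<longlongrightarrow> 0) (at z)"
      using \<delta>(1) by (auto intro!: tendsto_eq_intros)
  qed
  then show "?f field_differentiable at z within - \<real>\<^sub>\<le>\<^sub>0"
    using field_differentiable_at_within field_differentiable_def by blast
qed

end

section \<open>Lower bound and factorisation of the continued symbol\<close>

text \<open>A lower bound for the modulus of an integral needs a real-linear functional, which
  commutes with integration, comparable to the modulus on the sector. \<open>Re z + Im z\<close>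
  vanishes on the boundary ray of argument 3 pi / 4; the coefficient 2 keeps the functional positive
  there.\<close>

lemma norm_le_wedge_functional:
  assumes "Im z \<ge> 0" "Re z + Im z \<ge> 0"
  shows "norm z \<le> 2 * (Re z + 2 * Im z)"
  using cmod_le[of z] assms by (auto simp: abs_if split: if_splits)

text \<open>Multiplying by the conjugate, z / (z + t) = (|z|^2 + t z) / |z + t|^2. The functional of
  the numerator is at least |z| (|z| + t) / 2 by the previous estimate, and the denominator is at
  most (|z| + t)^2.\<close>

lemma complete_bernstein_factor_ge:
  fixes z :: complex
  assumes z: "Im z \<ge> 0" "Re z + Im z \<ge> 0" "z \<noteq> 0" and t: "t \<ge> 0"
  shows "norm z / (norm z + t) / 2 \<le> Re (z / (z + of_real t)) + 2 * Im (z / (z + of_real t))"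
proof -
  define D where "D = (norm (z + of_real t))\<^sup>2"
  have nz: "z + of_real t \<noteq> 0"
  proof
    assume "z + of_real t = 0"
    then have "Re z = - t" "Im z = 0" by (simp_all add: complex_eq_iff)
    with z t show False by (auto simp: complex_eq_iff)
  qed
  then have D: "D > 0" by (simp add: D_def)
  have D_le: "D \<le> (norm z + t)\<^sup>2"
    unfolding D_def using norm_triangle_ineq[of z "of_real t"] t by (intro power_mono) auto
  have "Re (z / (z + of_real t)) = ((norm z)\<^sup>2 + t * Re z) / D"
    unfolding D_def cmod_power2 by (simp add: Re_divide power2_eq_square algebra_simps)
  moreover have "Im (z / (z + of_real t)) = t * Im z / D"
    unfolding D_def cmod_power2 by (simp add: Im_divide power2_eq_square algebra_simps)
  ultimately have eq: "Re (z / (z + of_real t)) + 2 * Im (z / (z + of_real t)) =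
      ((norm z)\<^sup>2 + t * (Re z + 2 * Im z)) / D"
    by (simp add: add_divide_distrib[symmetric] algebra_simps)
  have "norm z / (norm z + t) / 2 = norm z * (norm z + t) / 2 / (norm z + t)\<^sup>2"
    using z(3) t by (simp add: power2_eq_square)
  also have "\<dots> \<le> norm z * (norm z + t) / 2 / D"
    using D D_le t z(3) by (intro divide_left_mono) (auto intro!: mult_pos_pos add_pos_nonneg)
  also have "\<dots> \<le> ((norm z)\<^sup>2 + t * (Re z + 2 * Im z)) / D"
  proof (rule divide_right_mono)
    have "t * norm z \<le> t * (2 * (Re z + 2 * Im z))"
      using norm_le_wedge_functional[OF z(1,2)] t by (rule mult_left_mono)
    moreover have "norm z * (norm z + t) / 2 = (norm z)\<^sup>2 / 2 + t * norm z / 2"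
      by (simp add: power2_eq_square algebra_simps)
    moreover have "(norm z)\<^sup>2 \<ge> 0" by simp
    ultimately show "norm z * (norm z + t) / 2 \<le> (norm z)\<^sup>2 + t * (Re z + 2 * Im z)"
      by linarith
  qed (use D in simp)
  finally show ?thesis unfolding eq .
qed

text \<open>This collects everything that is later drawn from the Stieltjes representation. The
  clause about S encodes three facts at once: p is the only solution of \<open>L z = L p\<close> on
  the slit plane, it is a simple one, and L increases on the positive axis.\<close>

lemma standing_kernel_complex_extension:
  assumes k: "standing_kernel k"
  shows "\<exists>L. L holomorphic_on - \<real>\<^sub>\<le>\<^sub>0 \<and>
    (\<forall>x>0. L (of_real x) = of_real (lapL k x)) \<and>
    (\<forall>z. Im z \<ge> 0 \<longrightarrow> Re z + Im z \<ge> 0 \<longrightarrow> z \<noteq> 0 \<longrightarrow> lapL k (norm z) / 6 \<le> norm (L z)) \<and>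
    (\<forall>p>0. \<exists>S. S holomorphic_on - \<real>\<^sub>\<le>\<^sub>0 \<and>
      (\<forall>z\<in>- \<real>\<^sub>\<le>\<^sub>0. L z - L (of_real p) = (z - of_real p) * S z \<and> S z \<noteq> 0) \<and>
      (\<forall>x>0. \<exists>y>0. S (of_real x) = of_real y))"
proof -
  from k obtain A B \<sigma> where AB: "A \<ge> 0" "B \<ge> 0"
    and \<sigma>: "sets \<sigma> = sets borel" "emeasure \<sigma> {..<0} = 0" "(\<integral>\<^sup>+ t. ennreal (1 / (1 + t)) \<partial>\<sigma>) < \<infinity>"
    and K: "\<And>x. x > 0 \<Longrightarrow> lapK k x = A / x + B + (\<integral> t. 1 / (x + t) \<partial>\<sigma>)"
    unfolding standing_kernel_def stieltjes_function_def by blast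
  note [measurable_cong] = \<sigma>(1)
  note AE = stieltjes_AE_nonneg[OF \<sigma>]
  define I where "I z = (CLINT t|\<sigma>. 1 / (z + of_real t))" for z
  define L where "L z = of_real A + of_real B * z + z * I z" for z
  have int1: "integrable \<sigma> (\<lambda>t. 1 / (z + of_real t) :: complex)" if "z \<notin> \<real>\<^sub>\<le>\<^sub>0" for z
    using stieltjes_transform_integrable[OF \<sigma>, of "\<lambda>_. 1" z] that by simp
  have I_hol: "I holomorphic_on - \<real>\<^sub>\<le>\<^sub>0"
    using stieltjes_transform_holomorphic[OF \<sigma>, of "\<lambda>_. 1"] by (simp add: I_def[abs_def])
  have L_hol: "L holomorphic_on - \<real>\<^sub>\<le>\<^sub>0"
    unfolding L_def[abs_def] by (intro holomorphic_intros I_hol)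
  have mulK: "lapL k x = A + B * x + x * (\<integral> t. 1 / (x + t) \<partial>\<sigma>)" if "x > 0" for x
  proof -
    have "x * (A / x + B + j) = A + B * x + x * j" for j
      using that by (simp add: field_simps)
    then show ?thesis unfolding lapL_def K[OF that] .
  qed
  have lapL: "lapL k x = A + B * x + (\<integral> t. x / (x + t) \<partial>\<sigma>)" if "x > 0" for x
    unfolding mulK[OF that] integral_mult_right_zero[symmetric] by simp
  have L_real: "L (of_real x) = of_real (lapL k x)" if "x > 0" for x
  proof -
    have "I (of_real x) = (CLINT t|\<sigma>. of_real (1 / (x + t)))"
      by (simp add: I_def)
    also have "\<dots> = of_real (\<integral> t. 1 / (x + t) \<partial>\<sigma>)" by (rule integral_complex_of_real)
    finally show ?thesis unfolding mulK[OF that] L_def by (simp only: of_real_add of_real_mult)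
  qed
  \<comment> \<open>If B = 0 and \<open>\<sigma>\<close> were concentrated at 0, L would be constant
    on the positive axis, against its divergence at infinity.\<close>
  have nonconst: "B > 0 \<or> \<not> (AE t in \<sigma>. t = 0)"
  proof (rule ccontr)
    assume "\<not> (B > 0 \<or> \<not> (AE t in \<sigma>. t = 0))"
    then have B: "B = 0" and z: "AE t in \<sigma>. t = 0" using AB by auto
    have "lapL k x = A + (\<integral> t. 1 \<partial>\<sigma>)" if "x > 0" for x
    proof -
      have "(\<integral> t. x / (x + t) \<partial>\<sigma>) = (\<integral> t. 1 \<partial>\<sigma>)"
        by (rule integral_cong_AE) (use z that in \<open>auto elim!: eventually_mono\<close>)
      then show ?thesis using lapL[OF that] B by simp
    qed
    then have "\<forall>\<^sub>F x in at_top. lapL k x = A + (\<integral> t. 1 \<partial>\<sigma>)"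
      using eventually_gt_at_top[of 0] by (rule eventually_mono[rotated])
    moreover have "\<forall>\<^sub>F x in at_top. lapL k x > A + (\<integral> t. 1 \<partial>\<sigma>)"
      using k unfolding standing_kernel_def filterlim_at_top_dense by blast
    ultimately have "\<forall>\<^sub>F x in at_top :: real filter. False"
      by eventually_elim simp
    then show False by simp
  qed
  \<comment> \<open>The common source of two strict inequalities: the positivity of S on the
    positive axis and of Im L / Im z off the real axis. Both integrands vanish at t = 0, so a mass
    of \<open>\<sigma>\<close> at the origin does not help and \<open>nonconst\<close> is
    needed.\<close>
  have pos: "0 < B + (\<integral> t. h t \<partial>\<sigma>)" if "integrable \<sigma> h" "\<And>t. t > 0 \<Longrightarrow> h t > 0" "h 0 = 0" for h :: "real \<Rightarrow> real"
  proof -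
    have h: "AE t in \<sigma>. 0 \<le> h t"
      using AE by eventually_elim (use that(2,3) in \<open>metis order_le_less\<close>)
    then have nn: "0 \<le> (\<integral> t. h t \<partial>\<sigma>)" by (rule integral_nonneg_AE)
    show ?thesis
    proof (cases "B > 0")
      case False
      with nonconst have nz: "\<not> (AE t in \<sigma>. t = 0)" by simp
      have "(\<integral> t. h t \<partial>\<sigma>) \<noteq> 0"
      proof
        assume "(\<integral> t. h t \<partial>\<sigma>) = 0"
        then have "AE t in \<sigma>. h t = 0"
          using integral_nonneg_eq_0_iff_AE[OF that(1) h] by simp
        with AE have "AE t in \<sigma>. t = 0"
          by eventually_elim (use that(2) in \<open>metis order_le_less less_irrefl\<close>)
        with nz show False by simp
      qed
      then show ?thesis using nn AB by simp
    qed (use nn in simp)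
  qed
  have slit: "of_real x \<in> - \<real>\<^sub>\<le>\<^sub>0" if "x > 0" for x :: real
    using that by (simp add: complex_nonpos_Reals_iff)
  \<comment> \<open>The 6 is the product of the factor 2 lost in the pointwise estimate and the 3
    from \<open>Re + 2 Im \<le> 3 |L|\<close>.\<close>
  have wedge: "lapL k (norm z) / 6 \<le> norm (L z)" if z: "Im z \<ge> 0" "Re z + Im z \<ge> 0" "z \<noteq> 0" for z
  proof -
    have zs: "z \<notin> \<real>\<^sub>\<le>\<^sub>0" using z by (auto simp: complex_nonpos_Reals_iff complex_eq_iff)
    have iz: "integrable \<sigma> (\<lambda>t. z / (z + of_real t))"
      using integrable_mult_right[OF int1[OF zs], of z] by simp
    have "integrable \<sigma> (\<lambda>t. of_real (norm z / (norm z + t)) :: complex)"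
      using integrable_mult_right[OF int1[of "of_real (norm z)"], of "of_real (norm z)"] slit[of "norm z"] z(3) by simp
    then have in2: "integrable \<sigma> (\<lambda>t. norm z / (norm z + t))"
      using complex_of_real_integrable_eq by blast
    have Lz: "L z = of_real A + of_real B * z + (CLINT t|\<sigma>. z / (z + of_real t))"
      unfolding L_def I_def integral_mult_right_zero[symmetric] by simp
    have "lapL k (norm z) / 2 = A / 2 + B * (norm z / 2) + (\<integral> t. norm z / (norm z + t) \<partial>\<sigma>) / 2"
      using lapL[of "norm z"] z(3) by simp
    also have "(\<integral> t. norm z / (norm z + t) \<partial>\<sigma>) / 2 = (\<integral> t. norm z / (norm z + t) / 2 \<partial>\<sigma>)"
      by (rule integral_divide_zero[symmetric])
    also have "(\<integral> t. norm z / (norm z + t) / 2 \<partial>\<sigma>) \<le> (\<integral> t. Re (z / (z + of_real t)) + 2 * Im (z / (z + of_real t)) \<partial>\<sigma>)"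
    proof (rule integral_mono_AE)
      show "AE t in \<sigma>. norm z / (norm z + t) / 2 \<le> Re (z / (z + of_real t)) + 2 * Im (z / (z + of_real t))"
        using AE by eventually_elim (rule complete_bernstein_factor_ge[OF z])
      show "integrable \<sigma> (\<lambda>t. norm z / (norm z + t) / 2)"
        using in2 by (rule integrable_divide_zero)
    qed (use iz in auto)
    also have "\<dots> = Re (CLINT t|\<sigma>. z / (z + of_real t)) + 2 * Im (CLINT t|\<sigma>. z / (z + of_real t))"
      using iz by simp
    also have "A / 2 + B * (norm z / 2) + (Re (CLINT t|\<sigma>. z / (z + of_real t)) + 2 * Im (CLINT t|\<sigma>. z / (z + of_real t)))
      \<le> Re (L z) + 2 * Im (L z)"
    proof -
      have "B * (norm z / 2) \<le> B * (Re z + 2 * Im z)"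
        using norm_le_wedge_functional[OF z(1,2)] AB by (intro mult_left_mono) auto
      then show ?thesis unfolding Lz using AB by (simp add: algebra_simps)
    qed
    also have "\<dots> \<le> 3 * norm (L z)"
      using abs_Re_le_cmod[of "L z"] abs_Im_le_cmod[of "L z"] by linarith
    finally show ?thesis by simp
  qed
  have div: "\<exists>S. S holomorphic_on - \<real>\<^sub>\<le>\<^sub>0 \<and>
      (\<forall>z\<in>- \<real>\<^sub>\<le>\<^sub>0. L z - L (of_real p) = (z - of_real p) * S z \<and> S z \<noteq> 0) \<and>
      (\<forall>x>0. \<exists>y>0. S (of_real x) = of_real y)" if p: "p > 0" for p
  proof -
    \<comment> \<open>the absolute value only serves to make the weight bounded and measurable on the whole line\<close>
    define g where "g t = t / (p + \<bar>t\<bar>)" for t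
    have gm: "g \<in> borel_measurable borel" unfolding g_def[abs_def] by measurable
    have g1: "\<bar>g t\<bar> \<le> 1" for t using p by (simp add: g_def)
    \<comment> \<open>The formula comes from z / (z + t) - p / (p + t) = (z - p) * t / ((p + t) (z +
      t)), integrated against \<open>\<sigma>\<close>.\<close>
    define S where "S z = of_real B + (CLINT t|\<sigma>. of_real (g t) / (z + of_real t))" for z
    have gi: "integrable \<sigma> (\<lambda>t. of_real (g t) / (z + of_real t) :: complex)" if "z \<notin> \<real>\<^sub>\<le>\<^sub>0" for z
      by (rule stieltjes_transform_integrable[OF \<sigma> gm g1 that])
    have S_hol: "S holomorphic_on - \<real>\<^sub>\<le>\<^sub>0"
      unfolding S_def[abs_def]
      by (intro holomorphic_intros stieltjes_transform_holomorphic[OF \<sigma> gm g1])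
    have eq: "L z - L (of_real p) = (z - of_real p) * S z" if z: "z \<in> - \<real>\<^sub>\<le>\<^sub>0" for z
    proof -
      have iz: "integrable \<sigma> (\<lambda>t. z * (1 / (z + of_real t)))"
        using z by (intro integrable_mult_right int1) simp
      have ip: "integrable \<sigma> (\<lambda>t. of_real p * (1 / (of_real p + of_real t)) :: complex)"
        using slit[OF p] by (intro integrable_mult_right int1) simp
      have "z * I z - of_real p * I (of_real p) = (CLINT t|\<sigma>. z * (1 / (z + of_real t)) - of_real p * (1 / (of_real p + of_real t)))"
        unfolding I_def by (simp only: Bochner_Integration.integral_diff[OF iz ip] integral_mult_right_zero)
      also have "\<dots> = (CLINT t|\<sigma>. (z - of_real p) * (of_real (g t) / (z + of_real t)))"
      proof (rule integral_cong_AE)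
        show "AE t in \<sigma>. z * (1 / (z + of_real t)) - of_real p * (1 / (of_real p + of_real t)) =
            (z - of_real p) * (of_real (g t) / (z + of_real t))"
          using AE
        proof eventually_elim
          case (elim t)
          have "z + of_real t \<noteq> 0"
            using z elim by (auto simp: complex_nonpos_Reals_iff complex_eq_iff)
          moreover have "of_real p + of_real t \<noteq> (0 :: complex)"
            using p elim by (metis add_pos_nonneg less_irrefl of_real_add of_real_eq_0_iff)
          ultimately show ?case using elim
            by (simp add: g_def divide_simps) (simp add: algebra_simps)
        qed
      qed (use gm in measurable)
      also have "\<dots> = (z - of_real p) * (CLINT t|\<sigma>. of_real (g t) / (z + of_real t))"
        by (rule integral_mult_right_zero)
      finally show ?thesis by (simp add: L_def S_def algebra_simps)
    qed
    have S_real: "\<exists>y>0. S (of_real x) = of_real y" if x: "x > 0" for x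
    proof (intro exI conjI)
      have *: "(\<lambda>t. of_real (g t) / (of_real x + of_real t) :: complex) = (\<lambda>t. of_real (g t / (x + t)))"
        by auto
      show "S (of_real x) = of_real (B + (\<integral>t. g t / (x + t) \<partial>\<sigma>))"
        unfolding S_def * integral_complex_of_real by simp
      have "integrable \<sigma> (\<lambda>t. g t / (x + t))"
        using gi[of "of_real x"] slit[OF x] unfolding * using complex_of_real_integrable_eq by blast
      then show "0 < B + (\<integral>t. g t / (x + t) \<partial>\<sigma>)"
        using p x by (intro pos) (auto simp: g_def)
    qed
    \<comment> \<open>L maps each open half-plane to itself, since Im (z / (z + t)) = t Im z / |z +
      t|^2. As L p is real, S has no zero off the real axis.\<close>
    have Im_L: "Im (L z) \<noteq> 0" if z: "Im z \<noteq> 0" for z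
    proof -
      have zs: "z \<notin> \<real>\<^sub>\<le>\<^sub>0" using z by (auto simp: complex_nonpos_Reals_iff)
      have iz: "integrable \<sigma> (\<lambda>t. z / (z + of_real t))"
        using integrable_mult_right[OF int1[OF zs], of z] by simp
      have h: "Im (z / (z + of_real t)) / Im z = t / (norm (z + of_real t))\<^sup>2" for t
      proof -
        have "Im (z / (z + of_real t)) = t * Im z / (norm (z + of_real t))\<^sup>2"
          unfolding cmod_power2 by (simp add: Im_divide algebra_simps)
        with z show ?thesis by simp
      qed
      have "integrable \<sigma> (\<lambda>t. Im (z / (z + of_real t)) / Im z)"
        using iz by auto
      then have "0 < B + (\<integral>t. Im (z / (z + of_real t)) / Im z \<partial>\<sigma>)"
      proof (rule pos)
        fix t :: real assume "t > 0"
        moreover have "z + of_real t \<noteq> 0" using z by (auto simp: complex_eq_iff)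
        ultimately show "0 < Im (z / (z + of_real t)) / Im z" unfolding h by simp
      qed (use z in \<open>simp add: h\<close>)
      also have "(\<integral>t. Im (z / (z + of_real t)) / Im z \<partial>\<sigma>) = Im (CLINT t|\<sigma>. z / (z + of_real t)) / Im z"
        using iz by simp
      finally have nz: "Im z * (B + Im (CLINT t|\<sigma>. z / (z + of_real t)) / Im z) \<noteq> 0"
        using z by simp
      have "Im (L z) = Im (of_real A + of_real B * z + (CLINT t|\<sigma>. z / (z + of_real t)))"
        unfolding L_def I_def integral_mult_right_zero[symmetric] by simp
      also have "\<dots> = Im z * (B + Im (CLINT t|\<sigma>. z / (z + of_real t)) / Im z)"
        using z by (simp add: field_simps)
      finally show ?thesis using nz by simp
    qed
    have S_nz: "S z \<noteq> 0" if z: "z \<in> - \<real>\<^sub>\<le>\<^sub>0" for z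
    proof (cases "Im z = 0")
      case True
      then have "Re z > 0" "z = of_real (Re z)"
        using z by (auto simp: complex_nonpos_Reals_iff complex_eq_iff)
      then show ?thesis using S_real[of "Re z"] by (metis less_irrefl of_real_eq_0_iff)
    next
      case False
      have "Im (L z - L (of_real p)) = Im (L z)" using L_real[OF p] by simp
      then show ?thesis using Im_L[OF False] eq[OF z] by auto
    qed
    show ?thesis using S_hol eq S_nz S_real by blast
  qed
  show ?thesis using L_hol L_real wedge div by blast
qed

section \<open>Laplace inversion along the boundary of a wedge\<close>

lemma slit_plane_starlike: "starlike (- \<real>\<^sub>\<le>\<^sub>0 :: complex set)"
proof -
  have "(\<real>\<^sub>\<le>\<^sub>0 :: complex set) = complex_of_real ` {..0}"
    by (auto simp: nonpos_Reals_def)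
  then show ?thesis using starlike_slotted_complex_plane_left[of 0] by simp
qed

text \<open>The singularity at a is removable. Reality of Q on the axis is algebraic away from a; at
  a itself it is inherited as a limit from the right.\<close>

lemma slit_plane_difference_quotient:
  assumes hol: "f holomorphic_on - \<real>\<^sub>\<le>\<^sub>0" and real: "\<And>x. x > 0 \<Longrightarrow> Im (f (of_real x)) = 0" and a: "a > 0"
  obtains Q where "Q holomorphic_on - \<real>\<^sub>\<le>\<^sub>0" "\<And>z. f z - f (of_real a) = (z - of_real a) * Q z"
    "\<And>x. x > 0 \<Longrightarrow> Im (Q (of_real x)) = 0"
proof -
  define Q where "Q z = (if z = of_real a then deriv f (of_real a) else (f z - f (of_real a)) / (z - of_real a))" for z
  have Qh: "Q holomorphic_on - \<real>\<^sub>\<le>\<^sub>0"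
    unfolding Q_def[abs_def] by (rule pole_lemma_open[OF hol open_Compl[OF closed_nonpos_Reals_complex]])
  have off: "Im (Q (of_real x)) = 0" if "x > 0" "x \<noteq> a" for x
  proof -
    have "Im ((f (of_real x) - f (of_real a)) / of_real (x - a)) = 0"
      using real[OF that(1)] real[OF a] by (simp only: Im_divide_of_real) simp
    then show ?thesis using that by (simp add: Q_def)
  qed
  have "continuous_on (- \<real>\<^sub>\<le>\<^sub>0) Q" using Qh by (rule holomorphic_on_imp_continuous_on)
  then have "isCont Q (of_real a)"
    using a by (simp add: continuous_on_eq_continuous_at[OF open_Compl[OF closed_nonpos_Reals_complex]]
      complex_nonpos_Reals_iff)
  then have "isCont (\<lambda>x. Im (Q (of_real x))) a"
    by (intro isCont_Im isCont_o2[where f = of_real and g = Q] continuous_of_real continuous_ident)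
  then have "((\<lambda>x. Im (Q (of_real x))) \<longlongrightarrow> Im (Q (of_real a))) (at_right a)"
    by (simp add: isCont_def filterlim_at_split)
  moreover have "\<forall>\<^sub>F x in at_right a. Im (Q (of_real x)) = 0"
    using a by (intro eventually_at_right_less[THEN eventually_mono]) (auto intro!: off)
  then have "((\<lambda>x. Im (Q (of_real x))) \<longlongrightarrow> 0) (at_right a)"
    by (simp add: tendsto_eventually)
  ultimately have "Im (Q (of_real a)) = 0"
    using tendsto_unique trivial_limit_at_right_real by blast
  with off have "\<And>x. x > 0 \<Longrightarrow> Im (Q (of_real x)) = 0" by metis
  with Qh show ?thesis by (intro that[of Q]) (auto simp: Q_def)
qed

text \<open>Any direction in the open second quadrant would do: it makes \<open>exp (z t)\<close> decay along the ray, while the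
  region to its right stays in a sector away from the cut.\<close>

definition wedge_ray :: "real \<Rightarrow> real \<Rightarrow> complex" where
  "wedge_ray c r = Complex (c - r) r"

lemma wedge_ray_sel [simp]: "Re (wedge_ray c r) = c - r" "Im (wedge_ray c r) = r"
  by (simp_all add: wedge_ray_def)

lemma wedge_ray_derivative: "(wedge_ray c has_vector_derivative Complex (-1) 1) (at r within S)"
proof -
  have "wedge_ray c = (\<lambda>r. of_real c + r *\<^sub>R Complex (-1) 1)"
    by (auto simp: wedge_ray_def complex_eq_iff)
  then show ?thesis by (auto intro!: derivative_eq_intros simp: has_vector_derivative_def)
qed

lemma wedge_ray_measurable [measurable]: "wedge_ray c \<in> borel_measurable borel"
proof -
  have "wedge_ray c = (\<lambda>r. of_real (c - r) + of_real r * \<i>)"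
    by (auto simp: wedge_ray_def complex_eq_iff)
  then show ?thesis by simp
qed

lemma wedge_ray_not_nonpos: "c > 0 \<Longrightarrow> r \<ge> 0 \<Longrightarrow> wedge_ray c r \<notin> \<real>\<^sub>\<le>\<^sub>0"
  by (auto simp: complex_nonpos_Reals_iff)

text \<open>Along the ray the Moebius quotient (z + 1) / (q - z) runs from a positive number through
  the upper half-plane to -1, which lies on the cut of the logarithm. The factor
  \<open>- \<i>\<close> turns this path into the right half-plane, from the negative imaginary axis
  to \<open>\<i>\<close>, so the principal branch applies up to the limit. The gain in argument is
  pi, half of the full turn that both conjugate rays would give.\<close>

lemma wedge_kernel_primitive:
  assumes c: "c > 0" "c < q"
  defines "\<Phi> \<equiv> \<lambda>z. Ln (- \<i> * ((z + 1) / (of_real q - z)))"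
  shows "\<And>r. r \<ge> 0 \<Longrightarrow> (\<Phi> has_field_derivative (of_real q + 1) / ((wedge_ray c r + 1) * (of_real q - wedge_ray c r))) (at (wedge_ray c r))"
    and "((\<lambda>r. Im (\<Phi> (wedge_ray c r) - \<Phi> (of_real c))) \<longlongrightarrow> pi) at_top"
proof -
  fix r :: real assume r: "r \<ge> 0"
  define z where "z = wedge_ray c r"
  have nz: "z + 1 \<noteq> 0" "of_real q - z \<noteq> 0"
    using c r by (auto simp: z_def complex_eq_iff)
  define N where "N = (norm (of_real q - z))\<^sup>2"
  have N: "N > 0" using nz by (simp add: N_def)
  have Im: "Im ((z + 1) / (of_real q - z)) = r * (q + 1) / N"
    unfolding N_def cmod_power2 by (simp add: z_def Im_divide algebra_simps)
  have "- \<i> * ((z + 1) / (of_real q - z)) \<notin> \<real>\<^sub>\<le>\<^sub>0"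
  proof (cases "r = 0")
    case True
    then have "z = of_real c" by (simp add: z_def complex_eq_iff)
    then have "(z + 1) / (of_real q - z) = of_real ((c + 1) / (q - c))" by simp
    then show ?thesis using c by (simp only: complex_nonpos_Reals_iff) simp
  next
    case False
    then have "Im ((z + 1) / (of_real q - z)) > 0" unfolding Im using r c N by simp
    moreover have "- \<i> * w \<notin> \<real>\<^sub>\<le>\<^sub>0" if "Im w > 0" for w
      using that by (auto simp: complex_nonpos_Reals_iff)
    ultimately show ?thesis by blast
  qed
  then show "(\<Phi> has_field_derivative (of_real q + 1) / ((wedge_ray c r + 1) * (of_real q - wedge_ray c r))) (at (wedge_ray c r))"
    unfolding \<Phi>_def z_def[symmetric] using nz
    by (auto intro!: derivative_eq_intros simp: divide_simps) (auto simp: algebra_simps)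
next
  have "filterlim (\<lambda>r. of_real q + - wedge_ray c r) at_infinity at_top"
    unfolding filterlim_at_infinity_conv_norm_at_top
  proof (rule filterlim_at_top_mono[OF filterlim_ident])
    have "r \<le> norm (of_real q + - wedge_ray c r)" for r
      using abs_Im_le_cmod[of "of_real q + - wedge_ray c r"] by simp
    then show "\<forall>\<^sub>F r in at_top. r \<le> norm (of_real q + - wedge_ray c r)"
      by (intro always_eventually allI)
  qed
  then have "((\<lambda>r. (of_real q + 1) / (of_real q + - wedge_ray c r)) \<longlongrightarrow> 0) at_top"
    by (rule tendsto_divide_0[OF tendsto_const])
  then have "((\<lambda>r. - \<i> * (- 1 + (of_real q + 1) / (of_real q + - wedge_ray c r))) \<longlongrightarrow> - \<i> * (- 1 + 0)) at_top"
    by (intro tendsto_intros)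
  moreover have "\<forall>\<^sub>F r in at_top. - \<i> * (- 1 + (of_real q + 1) / (of_real q + - wedge_ray c r)) =
      - \<i> * ((wedge_ray c r + 1) / (of_real q - wedge_ray c r))"
    using eventually_gt_at_top[of 0]
  proof eventually_elim
    case (elim r)
    then have "of_real q - wedge_ray c r \<noteq> 0" by (auto simp: complex_eq_iff)
    then show ?case by (simp add: field_simps)
  qed
  ultimately have "((\<lambda>r. - \<i> * ((wedge_ray c r + 1) / (of_real q - wedge_ray c r))) \<longlongrightarrow> - \<i> * (- 1 + 0)) at_top"
    by (rule Lim_transform_eventually)
  then have "((\<lambda>r. - \<i> * ((wedge_ray c r + 1) / (of_real q - wedge_ray c r))) \<longlongrightarrow> \<i>) at_top"
    by simp
  then have "((\<lambda>r. \<Phi> (wedge_ray c r)) \<longlongrightarrow> Ln \<i>) at_top"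
    unfolding \<Phi>_def by (rule tendsto_Ln) (simp add: complex_nonpos_Reals_iff)
  then have "((\<lambda>r. Im (\<Phi> (wedge_ray c r) - \<Phi> (of_real c))) \<longlongrightarrow> Im (Ln \<i> - \<Phi> (of_real c))) at_top"
    by (intro tendsto_intros)
  moreover have "\<Phi> (of_real c) = Ln (of_real ((c + 1) / (q - c)) * (- \<i>))"
    by (simp add: \<Phi>_def mult.commute)
  moreover have "Ln (of_real ((c + 1) / (q - c)) * (- \<i>)) = of_real (ln ((c + 1) / (q - c))) + Ln (- \<i>)"
    using c by (subst Ln_times_of_real) (auto simp: Ln_of_real simp del: of_real_divide)
  ultimately show "((\<lambda>r. Im (\<Phi> (wedge_ray c r) - \<Phi> (of_real c))) \<longlongrightarrow> pi) at_top"
    by (simp del: of_real_divide)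
qed

text \<open>The singularity at q is split off explicitly, so that a primitive on the starlike slit
  plane replaces the residue theorem. The contour of the holomorphic rest is closed by a far
  segment, which contributes nothing in the limit, and by the real axis, where the integrand is real
  and drops out of the imaginary part.\<close>

lemma wedge_cauchy:
  fixes F :: "complex \<Rightarrow> complex"
  assumes c: "c > 0" and q: "c < q"
    and hol: "F holomorphic_on - \<real>\<^sub>\<le>\<^sub>0" and real: "\<And>x. x > 0 \<Longrightarrow> Im (F (of_real x)) = 0"
    and decay: "\<And>e. e > 0 \<Longrightarrow> \<exists>r0. \<forall>z. Im z \<ge> 0 \<longrightarrow> Re z + Im z \<ge> 0 \<longrightarrow> norm z \<ge> r0 \<longrightarrow> norm (F z) \<le> e"
  shows "((\<lambda>R. Im (integral {0..R} (\<lambda>r. Complex (-1) 1 * F (wedge_ray c r) / (of_real q - wedge_ray c r))))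
      \<longlongrightarrow> pi * Re (F (of_real q))) at_top"
proof -
  have q0: "q > 0" using c q by simp
  obtain Q where Q: "Q holomorphic_on - \<real>\<^sub>\<le>\<^sub>0"
    "\<And>z. F z * (z + 1) - F (of_real q) * (of_real q + 1) = (z - of_real q) * Q z"
    "\<And>x. x > 0 \<Longrightarrow> Im (Q (of_real x)) = 0"
  proof (rule slit_plane_difference_quotient[of "\<lambda>z. F z * (z + 1)" q])
    show "(\<lambda>z. F z * (z + 1)) holomorphic_on - \<real>\<^sub>\<le>\<^sub>0" by (intro holomorphic_intros hol)
    show "Im (F (of_real x) * (of_real x + 1)) = 0" if "x > 0" for x
      using real[OF that] by simp
  qed (use q0 in auto)
  \<comment> \<open>Subtracting \<open>F q / (q - z)\<close> alone would leave a term of order 1/R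
    on a segment of length of order R. The subtracted kernel with the additional factor
    \<open>(q + 1) / (z + 1)\<close> has the same singularity at q and decays like 1/R^2.\<close>
  define H where "H z = Q z / (z + 1)" for z
  have m1: "z + 1 \<noteq> 0" if "z \<notin> \<real>\<^sub>\<le>\<^sub>0" for z :: complex
    using that by (auto simp: complex_nonpos_Reals_iff complex_eq_iff)
  have H_hol: "H holomorphic_on - \<real>\<^sub>\<le>\<^sub>0"
    unfolding H_def[abs_def] using m1 by (intro holomorphic_intros Q(1)) auto
  have H_eq: "F z / (of_real q - z) = F (of_real q) * ((of_real q + 1) / ((z + 1) * (of_real q - z))) - H z"
    if "z \<notin> \<real>\<^sub>\<le>\<^sub>0" "z \<noteq> of_real q" for z
  proof -
    have "H z = (F z * (z + 1) - F (of_real q) * (of_real q + 1)) / ((z - of_real q) * (z + 1))"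
      unfolding H_def Q(2) using that by simp
    then show ?thesis using m1[OF that(1)] that(2) by (simp add: divide_simps) (simp add: algebra_simps)
  qed
  have "\<exists>P. \<forall>z\<in>- \<real>\<^sub>\<le>\<^sub>0. (P has_field_derivative H z) (at z)"
  proof (rule holomorphic_starlike_primitive[where k = "{}"])
    show "open (- \<real>\<^sub>\<le>\<^sub>0 :: complex set)" by (rule open_Compl[OF closed_nonpos_Reals_complex])
    then show "\<And>z. z \<in> - \<real>\<^sub>\<le>\<^sub>0 - {} \<Longrightarrow> H field_differentiable at z"
      using H_hol by (auto simp: holomorphic_on_open field_differentiable_def)
  qed (auto intro: slit_plane_starlike holomorphic_on_imp_continuous_on[OF H_hol])
  then obtain P where P: "\<And>z. z \<notin> \<real>\<^sub>\<le>\<^sub>0 \<Longrightarrow> (P has_field_derivative H z) (at z)" by auto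
  \<comment> \<open>H is real on the positive axis, so moving the endpoint from c to c + R does not
    change Im P.\<close>
  have P_real: "Im (P (of_real (c + R))) = Im (P (of_real c))" if R: "R \<ge> 0" for R
  proof -
    have "((\<lambda>x. Im (P (of_real x))) has_real_derivative 0) (at x within {c..c + R})" if "x \<in> {c..c+R}" for x
    proof -
      have "Im (Q (of_real x) / of_real (x + 1)) = 0"
        using Q(3)[of x] that c by (simp only: Im_divide_of_real) simp
      then have H0: "Im (H (of_real x)) = 0" by (simp add: H_def)
      have "(P has_field_derivative H (of_real x)) (at (of_real x))"
        using that c by (intro P) (simp add: complex_nonpos_Reals_iff)
      then have "((\<lambda>x. P (of_real x)) has_vector_derivative H (of_real x)) (at x)"
        using field_vector_diff_chain_at[of of_real 1 x P "H (of_real x)"]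
          bounded_linear.has_vector_derivative[OF bounded_linear_of_real has_vector_derivative_id[of "at x"]]
        by (simp add: o_def)
      then have "((\<lambda>x. Im (P (of_real x))) has_vector_derivative Im (H (of_real x))) (at x)"
        by (rule bounded_linear.has_vector_derivative[OF bounded_linear_Im])
      then show ?thesis
        unfolding H0 has_real_derivative_iff_has_vector_derivative by (rule has_vector_derivative_at_within)
    qed
    then obtain k where k: "\<And>x. x \<in> {c..c + R} \<Longrightarrow> Im (P (of_real x)) = k"
      using has_field_derivative_zero_constant[of "{c..c+R}" "\<lambda>x. Im (P (of_real x))"] by auto
    then show ?thesis using k[of "c + R"] k[of c] R by (simp del: of_real_add)
  qed
  have far: "((\<lambda>R. P (wedge_ray c R) - P (of_real (c + R))) \<longlongrightarrow> 0) at_top"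
  proof (rule tendstoI)
    fix e :: real assume e: "e > 0"
    \<comment> \<open>The closing segment has length at most 3 R and keeps distance at least R / 3
      from 0; once \<open>|z| \<ge> 2 q + 2\<close>, both |z - q| and |z + 1| are at least R / 6.
      Thus the F part of H is at most (e / 36) / (R / 6), and its integral at most e / 2; the
      explicit kernel contributes at most 36 C / R^2 times 3 R.\<close>
    obtain r0 where r0: "\<And>z. Im z \<ge> 0 \<Longrightarrow> Re z + Im z \<ge> 0 \<Longrightarrow> norm z \<ge> r0 \<Longrightarrow> norm (F z) \<le> e / 36"
      using decay[of "e / 36"] e by auto
    define C where "C = norm (F (of_real q)) * (q + 1)"
    have C: "C \<ge> 0" using q0 by (simp add: C_def)
    have "\<forall>\<^sub>F R in at_top. 108 * C / R < e / 2" using e by real_asymp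
    with eventually_ge_at_top[of "3 * r0"] eventually_ge_at_top[of "3 * (2 * q + 2)"]
    show "\<forall>\<^sub>F R in at_top. dist (P (wedge_ray c R) - P (of_real (c + R))) 0 < e"
    proof eventually_elim
      case (elim R)
      then have R: "R > 0" using q0 by simp
      let ?S = "closed_segment (wedge_ray c R) (of_real (c + R))"
      have seg: "z \<notin> \<real>\<^sub>\<le>\<^sub>0 \<and> norm (H z) \<le> (e / 6 + 36 * C / R) / R" if "z \<in> ?S" for z
      proof -
        from that obtain u where u: "0 \<le> u" "u \<le> 1" "z = (1 - u) *\<^sub>R wedge_ray c R + u *\<^sub>R of_real (c + R)"
          by (auto simp: in_segment)
        have Re: "Re z = c + R * (2 * u - 1)" and Im: "Im z = R * (1 - u)"
          unfolding u(3) by (simp_all add: algebra_simps)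
        have Im0: "Im z \<ge> 0" using R u Im by simp
        have "Re z + Im z = c + R * u" unfolding Re Im by (simp add: algebra_simps)
        then have w: "Re z + Im z > 0" using R u c by (simp add: add_pos_nonneg)
        have zs: "z \<notin> \<real>\<^sub>\<le>\<^sub>0" using Im0 w by (auto simp: complex_nonpos_Reals_iff)
        have zR: "R / 3 \<le> norm z"
        proof (cases "u \<le> 2/3")
          case True
          then have "R * (1/3) \<le> R * (1 - u)" using R by (intro mult_left_mono) auto
          then show ?thesis using abs_Im_le_cmod[of z] Im by simp
        next
          case False
          then have "R * (1/3) \<le> R * (2 * u - 1)" using R by (intro mult_left_mono) auto
          then show ?thesis using abs_Re_le_cmod[of z] Re c by simp
        qed
        have z1: "norm z \<ge> r0" "norm z \<ge> 2 * q + 2" using zR elim(1,2) by simp_all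
        have n1: "R / 6 \<le> norm (z - of_real q)"
          using norm_triangle_ineq2[of z "of_real q"] zR z1 q0 by simp
        have n2: "R / 6 \<le> norm (z + 1)"
          using norm_triangle_ineq2[of z "- 1"] zR z1 q0 by simp
        have zq: "z \<noteq> of_real q" using n1 R by auto
        have "norm (H z) = norm (F (of_real q) * ((of_real q + 1) / ((z + 1) * (of_real q - z))) - F z / (of_real q - z))"
          using H_eq[OF zs zq] by simp
        also have "\<dots> \<le> norm (F (of_real q) * ((of_real q + 1) / ((z + 1) * (of_real q - z)))) + norm (F z / (of_real q - z))"
          by (rule norm_triangle_ineq4)
        also have "norm (F (of_real q) * ((of_real q + 1) / ((z + 1) * (of_real q - z)))) = C / (norm (z + 1) * norm (z - of_real q))"
        proof -
          have "norm (of_real q + 1 :: complex) = q + 1"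
            using q0 by (metis add_pos_pos less_imp_le norm_of_real abs_of_nonneg of_real_1 of_real_add zero_less_one)
          then show ?thesis by (simp add: norm_mult norm_divide C_def norm_minus_commute)
        qed
        also have "\<dots> \<le> C / ((R / 6) * (R / 6))"
          using C R n1 n2 by (intro divide_left_mono mult_mono) (auto intro!: mult_pos_pos)
        also have "norm (F z / (of_real q - z)) \<le> (e / 36) / (R / 6)"
          unfolding norm_divide norm_minus_commute[of "of_real q"]
          using r0[OF Im0 less_imp_le[OF w] z1(1)] n1 R e by (intro frac_le) auto
        also have "C / ((R / 6) * (R / 6)) + (e / 36) / (R / 6) \<le> (e / 6 + 36 * C / R) / R"
          using R e by (simp add: field_simps)
        finally show ?thesis using zs by simp
      qed
      have "norm (P (wedge_ray c R) - P (of_real (c + R))) \<le> (e / 6 + 36 * C / R) / R * norm (wedge_ray c R - of_real (c + R))"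
        using seg by (intro field_differentiable_bound[of ?S P H]) (auto intro: has_field_derivative_at_within P)
      also have "\<dots> \<le> (e / 6 + 36 * C / R) / R * (3 * R)"
      proof (rule mult_left_mono)
        show "norm (wedge_ray c R - of_real (c + R)) \<le> 3 * R"
          using cmod_le[of "wedge_ray c R - of_real (c + R)"] R by simp
      qed (use R e C in simp)
      also have "\<dots> = e / 2 + 108 * C / R" using R by (simp add: field_simps)
      also have "\<dots> < e" using elim e by simp
      finally show ?case by (simp add: dist_norm)
    qed
  qed
  define \<Phi> where "\<Phi> z = Ln (- \<i> * ((z + 1) / (of_real q - z)))" for z
  note \<Phi> = wedge_kernel_primitive[OF c q, folded \<Phi>_def]
  have fundamental: "integral {0..R} (\<lambda>r. Complex (-1) 1 * F (wedge_ray c r) / (of_real q - wedge_ray c r)) =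
      F (of_real q) * (\<Phi> (wedge_ray c R) - \<Phi> (of_real c)) - (P (wedge_ray c R) - P (of_real c))" if R: "R \<ge> 0" for R
  proof -
    have "((\<lambda>r. Complex (-1) 1 * F (wedge_ray c r) / (of_real q - wedge_ray c r)) has_integral
       ((F (of_real q) * \<Phi> (wedge_ray c R) - P (wedge_ray c R)) - (F (of_real q) * \<Phi> (wedge_ray c 0) - P (wedge_ray c 0)))) {0..R}"
    proof (rule fundamental_theorem_of_calculus[OF R])
      fix r assume r: "r \<in> {0..R}"
      let ?z = "wedge_ray c r"
      have zs: "?z \<notin> \<real>\<^sub>\<le>\<^sub>0" using c r by (intro wedge_ray_not_nonpos) auto
      have zq: "?z \<noteq> of_real q" using q r by (auto simp: complex_eq_iff)
      have "((\<lambda>z. F (of_real q) * \<Phi> z - P z) has_field_derivative F ?z / (of_real q - ?z)) (at ?z)"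
        unfolding H_eq[OF zs zq] using r by (intro DERIV_diff DERIV_cmult \<Phi>(1) P zs) auto
      from field_vector_diff_chain_within[OF wedge_ray_derivative has_field_derivative_at_within[OF this]]
      show "((\<lambda>r. F (of_real q) * \<Phi> (wedge_ray c r) - P (wedge_ray c r)) has_vector_derivative
          Complex (-1) 1 * F ?z / (of_real q - ?z)) (at r within {0..R})"
        by (simp add: o_def)
    qed
    moreover have "wedge_ray c 0 = of_real c" by (simp add: complex_eq_iff)
    ultimately show ?thesis by (simp add: integral_unique algebra_simps)
  qed
  have Fq: "F (of_real q) = of_real (Re (F (of_real q)))"
    using real[OF q0] by (simp add: complex_eq_iff)
  have "((\<lambda>R. Re (F (of_real q)) * Im (\<Phi> (wedge_ray c R) - \<Phi> (of_real c)) - Im (P (wedge_ray c R) - P (of_real (c + R))))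
      \<longlongrightarrow> Re (F (of_real q)) * pi - Im 0) at_top"
    by (intro tendsto_intros \<Phi>(2) far)
  moreover have "\<forall>\<^sub>F R in at_top. Re (F (of_real q)) * Im (\<Phi> (wedge_ray c R) - \<Phi> (of_real c)) - Im (P (wedge_ray c R) - P (of_real (c + R))) =
      Im (integral {0..R} (\<lambda>r. Complex (-1) 1 * F (wedge_ray c r) / (of_real q - wedge_ray c r)))"
    using eventually_ge_at_top[of 0]
  proof eventually_elim
    case (elim R)
    have "Im (F (of_real q) * (\<Phi> (wedge_ray c R) - \<Phi> (of_real c))) = Re (F (of_real q)) * Im (\<Phi> (wedge_ray c R) - \<Phi> (of_real c))"
      using real[OF q0] by simp
    then show ?case using P_real[OF elim] unfolding fundamental[OF elim] by simp
  qed
  ultimately have "((\<lambda>R. Im (integral {0..R} (\<lambda>r. Complex (-1) 1 * F (wedge_ray c r) / (of_real q - wedge_ray c r))))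
      \<longlongrightarrow> Re (F (of_real q)) * pi - Im 0) at_top"
    by (rule Lim_transform_eventually)
  then show ?thesis by (simp add: mult.commute)
qed

section \<open>Exponential integrals along the ray\<close>

lemma complex_exp_integral_Ioi:
  fixes s :: complex
  assumes s: "Re s > 0"
  shows "set_integrable lborel {0<..} (\<lambda>t. exp (- s * of_real t))"
    and "(CLINT t:{0<..}|lborel. exp (- s * of_real t)) = 1 / s"
proof -
  show int: "set_integrable lborel {0<..} (\<lambda>t. exp (- s * of_real t))"
    unfolding set_integrable_def
  proof (rule integrableI_bounded)
    have "(\<integral>\<^sup>+ t. ennreal (norm (indicator {0<..} t *\<^sub>R exp (- s * of_real t))) \<partial>lborel) =
        (\<integral>\<^sup>+ t. ennreal (exp (- Re s * t)) * indicator {0<..} t \<partial>lborel)"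
      by (intro nn_integral_cong) (auto simp: indicator_def norm_exp)
    also have "\<dots> < \<infinity>" using nn_integral_exp_Ioi[OF s] by simp
    finally show "(\<integral>\<^sup>+ t. ennreal (norm (indicator {0<..} t *\<^sub>R exp (- s * of_real t))) \<partial>lborel) < \<infinity>" .
  qed measurable
  have s0: "s \<noteq> 0" using s by auto
  have "(LBINT t=ereal 0..\<infinity>. exp (- s * of_real t)) = 0 - (- exp (- s * of_real 0) / s)"
  proof (rule interval_integral_FTC_integrable[where F = "\<lambda>t. - exp (- s * of_real t) / s"])
    fix t :: real
    have "((\<lambda>z. - exp (- s * z) / s) has_field_derivative exp (- s * of_real t)) (at (of_real t))"
      using s0 by (auto intro!: derivative_eq_intros)
    from field_vector_diff_chain_at[OF bounded_linear.has_vector_derivative[OF bounded_linear_of_real has_vector_derivative_id[of "at t"]], simplified, OF this]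
    show "((\<lambda>t. - exp (- s * of_real t) / s) has_vector_derivative exp (- s * of_real t)) (at t)"
      by (simp add: o_def)
    show "isCont (\<lambda>t. exp (- s * of_real t)) t"
      by (intro continuous_intros)
  next
    show "set_integrable lborel (einterval (ereal 0) \<infinity>) (\<lambda>t. exp (- s * of_real t))"
      using int by simp
    have "isCont (\<lambda>t. - exp (- s * of_real t) / s) 0"
      using s0 by (intro continuous_intros)
    then show "(((\<lambda>t. - exp (- s * of_real t) / s) \<circ> real_of_ereal) \<longlongrightarrow> - exp (- s * of_real 0) / s) (at_right (ereal 0))"
      unfolding ereal_tendsto_simps by (simp only: isCont_def filterlim_at_split)
    have "((\<lambda>t. exp (- b * t) / m) \<longlongrightarrow> 0) at_top" if "b > 0" "m > 0" for b m :: real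
      using that by real_asymp
    from this[of "Re s" "norm s"] have "((\<lambda>t. exp (- Re s * t) / norm s) \<longlongrightarrow> 0) at_top"
      using s s0 by simp
    then have "((\<lambda>t. - exp (- s * of_real t) / s) \<longlongrightarrow> 0) at_top"
      by (rule tendsto_norm_zero_cancel[OF Lim_transform_eventually]) (simp add: norm_divide norm_exp)
    then show "(((\<lambda>t. - exp (- s * of_real t) / s) \<circ> real_of_ereal) \<longlongrightarrow> 0) (at_left \<infinity>)"
      unfolding ereal_tendsto_simps .
  qed simp
  then show "(CLINT t:{0<..}|lborel. exp (- s * of_real t)) = 1 / s"
    by (simp add: interval_integral_to_infinity_eq)
qed

lemma norm_exp_partial_sum_le:
  fixes z :: complex
  shows "norm (\<Sum>i<n. z ^ i / fact i) \<le> exp (norm z)"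
proof -
  have "norm (\<Sum>i<n. z ^ i / fact i) \<le> (\<Sum>i<n. norm (z ^ i / fact i))" by (rule norm_sum)
  also have "\<dots> = (\<Sum>i<n. norm z ^ i /\<^sub>R fact i)"
    by (simp add: norm_mult norm_power norm_inverse divide_inverse mult.commute)
  also have "\<dots> \<le> exp (norm z)"
    unfolding exp_def by (intro sum_le_suminf summable_exp_generic) auto
  finally show ?thesis .
qed

lemma norm_power_fact_le_exp:
  fixes x :: real
  assumes "x \<ge> 0"
  shows "x ^ i / fact i \<le> exp x"
proof -
  have "x ^ i / fact i = (\<Sum>j\<in>{i}. x ^ j /\<^sub>R fact j)" by (simp add: divide_inverse)
  also have "\<dots> \<le> exp x"
    unfolding exp_def using assms by (intro sum_le_suminf summable_exp_generic) auto
  finally show ?thesis .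
qed

text \<open>The upper half of a Bromwich integral on the tilted contour, for a general density on
  the ray. The direction \<open>Complex (-1) 1\<close> and the factor 1 / pi are supplied
  later.\<close>

definition wedge_transform :: "real \<Rightarrow> (real \<Rightarrow> complex) \<Rightarrow> real \<Rightarrow> complex" where
  "wedge_transform c f t = (CLINT r|lborel. exp (wedge_ray c r * of_real t) * f r)"

context
  fixes c :: real and f :: "real \<Rightarrow> complex"
  assumes c: "c > 0" and f: "integrable lborel f" and supp: "\<And>r. r < 0 \<Longrightarrow> f r = 0"
begin

lemma wedge_transform_norm_le:
  assumes t: "t \<ge> 0"
  shows "norm (wedge_transform c f t) \<le> (\<integral>r. norm (f r) \<partial>lborel) * exp (c * t)"
proof -
  have "norm (wedge_transform c f t) \<le> (\<integral>r. norm (exp (wedge_ray c r * of_real t) * f r) \<partial>lborel)"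
    unfolding wedge_transform_def by (rule integral_norm_bound)
  also have "\<dots> \<le> (\<integral>r. exp (c * t) * norm (f r) \<partial>lborel)"
  proof (rule integral_mono')
    show "integrable lborel (\<lambda>r. exp (c * t) * norm (f r))" using f by simp
    fix r :: real
    show "norm (exp (wedge_ray c r * of_real t) * f r) \<le> exp (c * t) * norm (f r)"
    proof (cases "r < 0")
      case False
      then have "(c - r) * t \<le> c * t" using t by (intro mult_right_mono) auto
      then show ?thesis by (simp add: norm_mult norm_exp mult_right_mono)
    qed (simp add: supp)
  qed simp
  finally show ?thesis by (simp add: mult.commute)
qed

text \<open>On the ray Re z = c - r while |z| is at most c + 2 r. For \<open>|h| \<le> x / 2\<close>
  the growth \<open>exp (r x)\<close> caused by h is cancelled exactly by the decay
  \<open>exp (- r x)\<close>, leaving a bound free of r; this fixes the radius x / 2 of the power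
  series.\<close>

lemma wedge_ray_exp_bound:
  assumes "r \<ge> 0" "\<bar>h\<bar> \<le> x / 2"
  shows "norm (exp (wedge_ray c r * of_real x)) * exp (norm (wedge_ray c r * of_real h)) \<le> exp (c * x + c * x / 2)"
proof -
  have "norm (wedge_ray c r) \<le> \<bar>c - r\<bar> + \<bar>r\<bar>" using cmod_le[of "wedge_ray c r"] by simp
  also have "\<dots> \<le> c + 2 * r" using assms c by simp
  finally have "norm (wedge_ray c r) * \<bar>h\<bar> \<le> (c + 2 * r) * (x / 2)"
    using assms c by (intro mult_mono) auto
  then show ?thesis
    by (simp add: norm_exp norm_mult exp_add[symmetric] algebra_simps)
qed

text \<open>\<open>exp (z h)\<close> is expanded under the integral. Its partial sums are bounded by
  \<open>exp (|z| |h|)\<close>, so the previous bound is the dominating constant for all of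
  them.\<close>

lemma wedge_transform_power_series:
  assumes x: "x > 0" and y: "\<bar>y - x\<bar> < x / 2"
  shows "(\<lambda>i. (CLINT r|lborel. wedge_ray c r ^ i / fact i * exp (wedge_ray c r * of_real x) * f r) * of_real (y - x) ^ i)
    sums wedge_transform c f y"
proof -
  have [measurable]: "f \<in> borel_measurable borel" using f by auto
  define M where "M = exp (c * x + c * x / 2)"
  define h where "h = y - x"
  let ?z = "wedge_ray c"
  \<comment> \<open>\<open>|z|^i / i!\<close> is at most \<open>(2 / x)^i * exp (|z| x / 2)\<close>,
    which brings back the same bound with h = x / 2.\<close>
  have int: "integrable lborel (\<lambda>r. ?z r ^ i / fact i * exp (?z r * of_real x) * f r)" for i
  proof (rule Bochner_Integration.integrable_bound)
    show "integrable lborel (\<lambda>r. (2 / x) ^ i * M * norm (f r))" using f by simp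
    have "norm (?z r ^ i / fact i * exp (?z r * of_real x) * f r) \<le> (2 / x) ^ i * M * norm (f r)" for r
    proof (cases "r < 0")
      case False
      have "norm (?z r) ^ i / fact i * norm (exp (?z r * of_real x)) =
          (2 / x) ^ i * (norm (exp (?z r * of_real x)) * ((norm (?z r) * (x / 2)) ^ i / fact i))"
        using x by (simp add: power_mult_distrib power_divide)
      also have "\<dots> \<le> (2 / x) ^ i * (norm (exp (?z r * of_real x)) * exp (norm (?z r) * (x / 2)))"
        using x by (intro mult_left_mono norm_power_fact_le_exp) auto
      also have "\<dots> \<le> (2 / x) ^ i * M"
        using wedge_ray_exp_bound[of r "x / 2" x] False x
        by (intro mult_left_mono) (auto simp: M_def norm_mult)
      finally have "norm (?z r) ^ i / fact i * norm (exp (?z r * of_real x)) * norm (f r) \<le> (2 / x) ^ i * M * norm (f r)"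
        by (rule mult_right_mono) simp
      then show ?thesis
        by (simp add: norm_mult norm_divide norm_power)
    qed (simp add: supp)
    then show "AE r in lborel. norm (?z r ^ i / fact i * exp (?z r * of_real x) * f r) \<le> norm ((2 / x) ^ i * M * norm (f r))"
      unfolding real_norm_def by (intro always_eventually allI order_trans[OF _ abs_ge_self])
  qed measurable
  have "(\<lambda>n. CLINT r|lborel. (\<Sum>i<n. (?z r * of_real h) ^ i / fact i) * (exp (?z r * of_real x) * f r))
      \<longlonglongrightarrow> (CLINT r|lborel. exp (?z r * of_real h) * (exp (?z r * of_real x) * f r))"
  proof (rule integral_dominated_convergence[where w = "\<lambda>r. M * norm (f r)"])
    show "AE r in lborel. (\<lambda>n. (\<Sum>i<n. (?z r * of_real h) ^ i / fact i) * (exp (?z r * of_real x) * f r))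
        \<longlonglongrightarrow> exp (?z r * of_real h) * (exp (?z r * of_real x) * f r)"
    proof (intro always_eventually allI tendsto_mult tendsto_const)
      fix r
      show "(\<lambda>n. \<Sum>i<n. (?z r * of_real h) ^ i / fact i) \<longlonglongrightarrow> exp (?z r * of_real h)"
        using exp_converges[of "?z r * of_real h"]
        by (simp add: sums_def scaleR_conv_of_real divide_inverse mult.commute)
    qed
    show "AE r in lborel. norm ((\<Sum>i<n. (?z r * of_real h) ^ i / fact i) * (exp (?z r * of_real x) * f r)) \<le> M * norm (f r)" for n
    proof (intro always_eventually allI)
      fix r
      show "norm ((\<Sum>i<n. (?z r * of_real h) ^ i / fact i) * (exp (?z r * of_real x) * f r)) \<le> M * norm (f r)"
      proof (cases "r < 0")
        case False
        have "norm (\<Sum>i<n. (?z r * of_real h) ^ i / fact i) * norm (exp (?z r * of_real x))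
            \<le> exp (norm (?z r * of_real h)) * norm (exp (?z r * of_real x))"
          by (intro mult_right_mono norm_exp_partial_sum_le) simp
        also have "\<dots> \<le> M"
          using wedge_ray_exp_bound[of r h x] False y by (simp add: M_def h_def mult.commute)
        finally have "norm (\<Sum>i<n. (?z r * of_real h) ^ i / fact i) * norm (exp (?z r * of_real x)) * norm (f r) \<le> M * norm (f r)"
          by (rule mult_right_mono) simp
        then show ?thesis by (simp only: norm_mult mult.assoc)
      qed (simp add: supp)
    qed
  qed (use f in auto)
  also have "(CLINT r|lborel. exp (?z r * of_real h) * (exp (?z r * of_real x) * f r)) = wedge_transform c f y"
    unfolding wedge_transform_def
    by (intro Bochner_Integration.integral_cong refl)
       (simp add: h_def mult.assoc[symmetric] exp_add[symmetric] algebra_simps del: mult.assoc)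
  also have "(\<lambda>n. CLINT r|lborel. (\<Sum>i<n. (?z r * of_real h) ^ i / fact i) * (exp (?z r * of_real x) * f r)) =
      (\<lambda>n. \<Sum>i<n. (CLINT r|lborel. ?z r ^ i / fact i * exp (?z r * of_real x) * f r) * of_real h ^ i)"
  proof
    fix n
    have "(CLINT r|lborel. (\<Sum>i<n. (?z r * of_real h) ^ i / fact i) * (exp (?z r * of_real x) * f r)) =
       (CLINT r|lborel. (\<Sum>i<n. (?z r ^ i / fact i * exp (?z r * of_real x) * f r) * of_real h ^ i))"
      by (intro Bochner_Integration.integral_cong refl)
         (simp add: sum_distrib_left power_mult_distrib mult_ac)
    also have "\<dots> = (\<Sum>i<n. CLINT r|lborel. (?z r ^ i / fact i * exp (?z r * of_real x) * f r) * of_real h ^ i)"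
      using int by (intro Bochner_Integration.integral_sum integrable_mult_left) auto
    finally show "(CLINT r|lborel. (\<Sum>i<n. (?z r * of_real h) ^ i / fact i) * (exp (?z r * of_real x) * f r)) =
       (\<Sum>i<n. (CLINT r|lborel. ?z r ^ i / fact i * exp (?z r * of_real x) * f r) * of_real h ^ i)"
      by (simp only: integral_mult_left_zero)
  qed
  finally show ?thesis unfolding sums_def h_def .
qed

text \<open>For q > c the whole ray lies to the left of q, with Re (q - z) = q - c + r. The inner
  integral of norms is then at most |f r| / (q - c), which justifies Fubini, and each exponential
  integrates to 1 / (q - z).\<close>

lemma wedge_transform_laplace:
  assumes q: "q > c"
  shows "set_integrable lborel {0<..} (\<lambda>t. of_real (exp (- q * t)) * wedge_transform c f t)"
    and "(CLINT t:{0<..}|lborel. of_real (exp (- q * t)) * wedge_transform c f t) =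
      (CLINT r|lborel. f r / (of_real q - wedge_ray c r))"
proof -
  have [measurable]: "f \<in> borel_measurable borel" using f by auto
  define J where "J r t = indicator {0<..} t *\<^sub>R exp (- (of_real q - wedge_ray c r) * of_real t) * f r" for r t :: real
  have Re_pos: "Re (of_real q - wedge_ray c r) > 0" if "r \<ge> 0" for r using q that by simp
  have J_int: "integrable lborel (J r)" for r
  proof (cases "r < 0")
    case True
    then show ?thesis by (simp add: J_def[abs_def] supp)
  next
    case False
    then have "integrable lborel (\<lambda>t. indicator {0<..} t *\<^sub>R exp (- (of_real q - wedge_ray c r) * of_real t))"
      using complex_exp_integral_Ioi(1)[OF Re_pos[of r]] by (simp add: set_integrable_def)
    then show ?thesis unfolding J_def[abs_def] by (rule integrable_mult_left)
  qed
  have J_val: "(CLINT t|lborel. J r t) = f r / (of_real q - wedge_ray c r)" for r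
  proof (cases "r < 0")
    case True
    then show ?thesis by (simp add: J_def supp)
  next
    case False
    have "(CLINT t|lborel. J r t) = (CLINT t|lborel. indicator {0<..} t *\<^sub>R exp (- (of_real q - wedge_ray c r) * of_real t)) * f r"
      unfolding J_def by (rule integral_mult_left_zero)
    also have "(CLINT t|lborel. indicator {0<..} t *\<^sub>R exp (- (of_real q - wedge_ray c r) * of_real t)) = 1 / (of_real q - wedge_ray c r)"
      using complex_exp_integral_Ioi(2)[OF Re_pos[of r]] False by (simp add: set_lebesgue_integral_def)
    finally show ?thesis by simp
  qed
  have J_norm: "(LINT t|lborel. norm (J r t)) = norm (f r) / (q - c + r)" for r
  proof (cases "r < 0")
    case True
    then show ?thesis by (simp add: J_def supp)
  next
    case False
    define b where "b = q - c + r"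
    have b: "b > 0" using False q by (simp add: b_def)
    have "(\<integral>\<^sup>+ t. ennreal (norm (J r t)) \<partial>lborel) = (\<integral>\<^sup>+ t. ennreal (norm (f r)) * (ennreal (exp (- b * t)) * indicator {0<..} t) \<partial>lborel)"
      by (intro nn_integral_cong)
         (auto simp: J_def b_def indicator_def norm_mult norm_exp ennreal_mult' mult.commute algebra_simps)
    also have "\<dots> = ennreal (norm (f r) / b)"
      using b by (subst nn_integral_cmult) (simp_all only: nn_integral_exp_Ioi, simp_all add: ennreal_mult'[symmetric])
    finally show ?thesis
      using b unfolding b_def[symmetric] by (subst integral_eq_nn_integral) (auto simp: J_def)
  qed
  have [measurable]: "(\<lambda>(r, t). J r t) \<in> borel_measurable (lborel \<Otimes>\<^sub>M lborel)"
    unfolding J_def by measurable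
  have prod: "integrable (lborel \<Otimes>\<^sub>M lborel) (\<lambda>(r, t). J r t)"
  proof (rule lborel_pair.Fubini_integrable)
    show "integrable lborel (\<lambda>r. LINT t|lborel. norm (case (r, t) of (r, t) \<Rightarrow> J r t))"
      unfolding prod.case J_norm
    proof (rule Bochner_Integration.integrable_bound)
      show "integrable lborel (\<lambda>r. norm (f r) / (q - c))" using f by simp
      have "norm (norm (f r) / (q - c + r)) \<le> norm (norm (f r) / (q - c))" for r
        using q by (cases "r < 0") (auto simp: supp intro!: divide_left_mono mult_pos_pos)
      then show "AE r in lborel. norm (norm (f r) / (q - c + r)) \<le> norm (norm (f r) / (q - c))"
        by (intro always_eventually allI)
    qed measurable
    show "AE r in lborel. integrable lborel (\<lambda>t. case (r, t) of (r, t) \<Rightarrow> J r t)"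
      using J_int by simp
  qed measurable
  have inner: "(CLINT r|lborel. J r t) = indicator {0<..} t *\<^sub>R (of_real (exp (- q * t)) * wedge_transform c f t)" for t
  proof -
    have "(CLINT r|lborel. J r t) = (CLINT r|lborel. (indicator {0<..} t *\<^sub>R of_real (exp (- q * t))) * (exp (wedge_ray c r * of_real t) * f r))"
    proof (intro Bochner_Integration.integral_cong refl)
      fix r
      have "exp (- (of_real q - wedge_ray c r) * of_real t) = of_real (exp (- q * t)) * exp (wedge_ray c r * of_real t)"
        by (simp add: exp_of_real[symmetric] exp_add[symmetric] algebra_simps)
      then show "J r t = (indicator {0<..} t *\<^sub>R of_real (exp (- q * t))) * (exp (wedge_ray c r * of_real t) * f r)"
        by (simp add: J_def)
    qed
    also have "\<dots> = (indicator {0<..} t *\<^sub>R of_real (exp (- q * t))) * wedge_transform c f t"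
      unfolding wedge_transform_def by (rule integral_mult_right_zero)
    finally show ?thesis by simp
  qed
  show "set_integrable lborel {0<..} (\<lambda>t. of_real (exp (- q * t)) * wedge_transform c f t)"
    unfolding set_integrable_def inner[symmetric] using prod by (rule lborel_pair.integrable_snd)
  show "(CLINT t:{0<..}|lborel. of_real (exp (- q * t)) * wedge_transform c f t) =
      (CLINT r|lborel. f r / (of_real q - wedge_ray c r))"
    unfolding set_lebesgue_integral_def inner[symmetric] lborel_pair.Fubini_integral[OF prod] J_val ..
qed

end

section \<open>Real-analytic functions and almost everywhere equality\<close>

lemma real_analytic_on_linear_combination:
  assumes "real_analytic_on f S" "real_analytic_on g S"
  shows "real_analytic_on (\<lambda>x. a * f x + b * g x) S"
  unfolding real_analytic_on_def
proof
  fix x assume x: "x \<in> S"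
  obtain r1 c1 where 1: "r1 > 0" "\<And>y. \<bar>y - x\<bar> < r1 \<Longrightarrow> (\<lambda>i. c1 i * (y - x) ^ i) sums f y"
    using assms(1) x unfolding real_analytic_on_def by blast
  obtain r2 c2 where 2: "r2 > 0" "\<And>y. \<bar>y - x\<bar> < r2 \<Longrightarrow> (\<lambda>i. c2 i * (y - x) ^ i) sums g y"
    using assms(2) x unfolding real_analytic_on_def by blast
  have "(\<lambda>i. (a * c1 i + b * c2 i) * (y - x) ^ i) sums (a * f y + b * g y)" if "\<bar>y - x\<bar> < min r1 r2" for y
    using sums_add[OF sums_mult[OF 1(2)[of y], of a] sums_mult[OF 2(2)[of y], of b]] that
    by (simp add: algebra_simps)
  then show "\<exists>r>0. \<exists>c. \<forall>y. \<bar>y - x\<bar> < r \<longrightarrow> (\<lambda>i. c i * (y - x) ^ i) sums (a * f y + b * g y)"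
    using 1(1) 2(1) by (intro exI[of _ "min r1 r2"] conjI exI[of _ "\<lambda>i. a * c1 i + b * c2 i"]) auto
qed

lemma real_analytic_on_exp: "real_analytic_on (\<lambda>x. exp (b * x)) S"
  unfolding real_analytic_on_def
proof
  fix x assume "x \<in> S"
  have "(\<lambda>i. (exp (b * x) * b ^ i / fact i) * (y - x) ^ i) sums exp (b * y)" for y
  proof -
    have "exp (b * x) * ((b * (y - x)) ^ i /\<^sub>R fact i) = (exp (b * x) * b ^ i / fact i) * (y - x) ^ i" for i
      by (simp add: power_mult_distrib divide_inverse mult_ac)
    moreover have "exp (b * x) * exp (b * (y - x)) = exp (b * y)"
      by (simp add: exp_add[symmetric] algebra_simps)
    ultimately show ?thesis
      using sums_mult[OF exp_converges[of "b * (y - x)"], of "exp (b * x)"] by simp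
  qed
  then show "\<exists>r>0. \<exists>c. \<forall>y. \<bar>y - x\<bar> < r \<longrightarrow> (\<lambda>i. c i * (y - x) ^ i) sums exp (b * y)"
    by (intro exI[of _ 1] conjI exI[of _ "\<lambda>i. exp (b * x) * b ^ i / fact i"]) auto
qed

lemma real_analytic_on_imp_isCont:
  assumes "real_analytic_on f S" "x \<in> S"
  shows "isCont f x"
proof -
  obtain r c where r: "r > 0" and c: "\<And>y. \<bar>y - x\<bar> < r \<Longrightarrow> (\<lambda>i. c i * (y - x) ^ i) sums f y"
    using assms unfolding real_analytic_on_def by blast
  define g where "g h = (\<Sum>i. c i * h ^ i)" for h
  have "summable (\<lambda>i. c i * (r / 2) ^ i)"
    using c[of "x + r / 2"] r by (simp add: sums_iff)
  then have "isCont g 0"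
    unfolding g_def[abs_def] by (rule isCont_powser) (use r in simp)
  then have g: "isCont (\<lambda>y. g (y - x)) x"
    by (intro isCont_o2[where f = "\<lambda>y. y - x" and g = g] continuous_intros) simp
  have "\<forall>\<^sub>F y in nhds x. g (y - x) = f y"
    unfolding eventually_nhds_metric
    using c r by (intro exI[of _ r]) (auto simp: g_def sums_iff dist_real_def)
  then show ?thesis using g isCont_cong by metis
qed

text \<open>The set of disagreement is open and null, hence empty. This is what carries asymptotics
  from one analytic version of a moment to every other.\<close>

lemma AE_eq_imp_eq_on_open:
  fixes f g :: "real \<Rightarrow> real"
  assumes S: "open S" and f: "continuous_on S f" and g: "continuous_on S g"
    and AE: "AE t in lborel. t \<in> S \<longrightarrow> f t = g t" and t: "t \<in> S"
  shows "f t = g t"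
proof (rule ccontr)
  assume ne: "f t \<noteq> g t"
  define U where "U = {x \<in> S. f x - g x \<in> - {0}}"
  have "open U"
    unfolding U_def by (intro continuous_open_preimage[unfolded vimage_def Int_def, simplified] S) 
       (auto intro!: continuous_intros f g)
  moreover have "t \<in> U" using t ne by (simp add: U_def)
  ultimately have "\<not> negligible U" using open_not_negligible by blast
  moreover have "AE x in lborel. x \<notin> U"
    using AE by eventually_elim (auto simp: U_def)
  then have "U \<in> null_sets lborel"
    using \<open>open U\<close> by (subst AE_iff_null_sets) auto
  then have "negligible U"
    unfolding negligible_iff_null_sets by (rule null_sets_completionI)
  ultimately show False by simp
qed

text \<open>The bound \<open>exp (c t)\<close> reflects the starting point c of the ray, the
  analyticity its tilt. Decay of F in the sector closes the contour, while integrability on the ray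
  makes the candidate absolutely convergent.\<close>

lemma wedge_laplace_inversion:
  fixes F :: "complex \<Rightarrow> complex"
  assumes c: "c > 0"
    and hol: "F holomorphic_on - \<real>\<^sub>\<le>\<^sub>0" and real: "\<And>x. x > 0 \<Longrightarrow> Im (F (of_real x)) = 0"
    and decay: "\<And>e. e > 0 \<Longrightarrow> \<exists>r0. \<forall>z. Im z \<ge> 0 \<longrightarrow> Re z + Im z \<ge> 0 \<longrightarrow> norm z \<ge> r0 \<longrightarrow> norm (F z) \<le> e"
    and int: "set_integrable lborel {0..} (\<lambda>r. F (wedge_ray c r))"
  shows "\<exists>w C. real_analytic_on w {0<..} \<and> (\<forall>t\<ge>0. \<bar>w t\<bar> \<le> C * exp (c * t)) \<and>
    (\<forall>q>c. set_integrable lborel {0<..} (\<lambda>t. exp (- q * t) * w t) \<and>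
      (LINT t:{0<..}|lborel. exp (- q * t) * w t) = Re (F (of_real q)))"
proof -
  define d where "d = Complex (-1) 1"
  define f where "f r = indicator {0..} r *\<^sub>R F (wedge_ray c r)" for r
  have f: "integrable lborel f"
    using int unfolding set_integrable_def f_def[abs_def] .
  have supp: "f r = 0" if "r < 0" for r using that by (simp add: f_def)
  \<comment> \<open>The contour integral over both conjugate rays, divided by 2 pi i: the lower ray
    is traversed inwards and contributes minus the conjugate, so the sum is 2 i times an imaginary
    part.\<close>
  define w where "w t = Im (d * wedge_transform c f t) / pi" for t
  show ?thesis
  proof (rule exI[of _ w], rule exI[of _ "norm d * (\<integral>r. norm (f r) \<partial>lborel) / pi"], intro conjI allI impI)
    show "real_analytic_on w {0<..}"
      unfolding real_analytic_on_def
    proof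
      fix x :: real assume "x \<in> {0<..}"
      then have x: "x > 0" by simp
      define a where "a i = (CLINT r|lborel. wedge_ray c r ^ i / fact i * exp (wedge_ray c r * of_real x) * f r)" for i
      have "(\<lambda>i. Im (d * a i) / pi * (y - x) ^ i) sums w y" if "\<bar>y - x\<bar> < x / 2" for y
      proof -
        have "(\<lambda>i. a i * of_real (y - x) ^ i) sums wedge_transform c f y"
          unfolding a_def by (rule wedge_transform_power_series[OF c f supp x that])
        then have "(\<lambda>i. Im (d * (a i * of_real ((y - x) ^ i))) / pi) sums w y"
          unfolding w_def of_real_power by (intro sums_divide sums_Im sums_mult)
        moreover have "Im (d * (z * of_real s)) / pi = Im (d * z) / pi * s" for z s
          by (simp add: algebra_simps add_divide_distrib)
        ultimately show ?thesis by (simp only:)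
      qed
      then show "\<exists>r>0. \<exists>c. \<forall>y. \<bar>y - x\<bar> < r \<longrightarrow> (\<lambda>i. c i * (y - x) ^ i) sums w y"
        using x by (intro exI[of _ "x / 2"] conjI exI[of _ "\<lambda>i. Im (d * a i) / pi"]) auto
    qed
  next
    fix t :: real assume t: "t \<ge> 0"
    have "\<bar>Im (d * wedge_transform c f t)\<bar> \<le> norm d * norm (wedge_transform c f t)"
      using abs_Im_le_cmod[of "d * wedge_transform c f t"] by (simp add: norm_mult)
    also have "\<dots> \<le> norm d * ((\<integral>r. norm (f r) \<partial>lborel) * exp (c * t))"
      by (intro mult_left_mono wedge_transform_norm_le[OF c f supp t]) auto
    finally show "\<bar>w t\<bar> \<le> norm d * (\<integral>r. norm (f r) \<partial>lborel) / pi * exp (c * t)"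
      by (simp add: w_def divide_right_mono)
  next
    fix q assume q: "q > c"
    let ?W = "\<lambda>t. of_real (exp (- q * t)) * wedge_transform c f t"
    have W: "set_integrable lborel {0<..} ?W"
      by (rule wedge_transform_laplace(1)[OF c f supp q])
    then have dW: "integrable lborel (\<lambda>t. d * (indicator {0<..} t *\<^sub>R ?W t))"
      unfolding set_integrable_def by (rule integrable_mult_right)
    have eq: "indicator {0<..} t *\<^sub>R (exp (- q * t) * w t) = Im (d * (indicator {0<..} t *\<^sub>R ?W t)) / pi" for t
      by (simp add: w_def scaleR_conv_of_real algebra_simps)
    show "set_integrable lborel {0<..} (\<lambda>t. exp (- q * t) * w t)"
      unfolding set_integrable_def eq using dW by (intro integrable_divide_zero integrable_Im)
    let ?g = "\<lambda>r. d * (f r / (of_real q - wedge_ray c r))"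
    have g: "integrable lborel ?g"
    proof (rule integrable_mult_right, rule Bochner_Integration.integrable_bound)
      show "integrable lborel (\<lambda>r. norm (f r) / (q - c))" using f by simp
      show "(\<lambda>r. f r / (of_real q - wedge_ray c r)) \<in> borel_measurable lborel"
        using f by measurable
      have "norm (f r / (of_real q - wedge_ray c r)) \<le> norm (norm (f r) / (q - c))" for r
      proof (cases "r < 0")
        case False
        then have "q - c \<le> norm (of_real q - wedge_ray c r)"
          using abs_Re_le_cmod[of "of_real q - wedge_ray c r"] q by simp
        then show ?thesis using q by (auto simp: norm_divide intro!: divide_left_mono mult_pos_pos)
      qed (simp add: supp)
      then show "AE r in lborel. norm (f r / (of_real q - wedge_ray c r)) \<le> norm (norm (f r) / (q - c))"
        by (intro always_eventually allI)
    qed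
    \<comment> \<open>Cauchy's theorem gives only an improper integral as a limit in R; absolute
      convergence identifies that limit with the Lebesgue integral over the ray.\<close>
    have "((\<lambda>R. Im (CLINT r|lborel. indicator {..R} r *\<^sub>R ?g r)) \<longlongrightarrow> Im (CLINT r|lborel. ?g r)) at_top"
      using g by (intro tendsto_Im tendsto_integral_at_top) auto
    moreover have "(CLINT r|lborel. indicator {..R} r *\<^sub>R ?g r) =
        integral {0..R} (\<lambda>r. Complex (-1) 1 * F (wedge_ray c r) / (of_real q - wedge_ray c r))" for R
    proof -
      have *: "indicator {..R} r *\<^sub>R ?g r = indicator {0..R} r *\<^sub>R (Complex (-1) 1 * F (wedge_ray c r) / (of_real q - wedge_ray c r))" for r
        by (auto simp: indicator_def f_def d_def)
      have "integrable lborel (\<lambda>r. indicator {..R} r *\<^sub>R ?g r)"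
        using g by (intro integrable_mult_indicator) auto
      then have "set_integrable lborel {0..R} (\<lambda>r. Complex (-1) 1 * F (wedge_ray c r) / (of_real q - wedge_ray c r))"
        unfolding * set_integrable_def .
      then show ?thesis
        unfolding * using set_borel_integral_eq_integral(2) by (simp add: set_lebesgue_integral_def)
    qed
    ultimately have "Im (CLINT r|lborel. ?g r) = pi * Re (F (of_real q))"
      using wedge_cauchy[OF c q hol real decay] tendsto_unique[OF trivial_limit_at_top_linorder] by simp
    moreover have "(CLINT r|lborel. ?g r) = d * (CLINT r|lborel. f r / (of_real q - wedge_ray c r))"
      by (rule integral_mult_right_zero)
    moreover have "(LINT t:{0<..}|lborel. exp (- q * t) * w t) = Im (CLINT t|lborel. d * (indicator {0<..} t *\<^sub>R ?W t)) / pi"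
      unfolding set_lebesgue_integral_def eq integral_divide_zero integral_Im[OF dW] ..
    moreover have "(CLINT t|lborel. d * (indicator {0<..} t *\<^sub>R ?W t)) = d * (CLINT t:{0<..}|lborel. ?W t)"
      unfolding set_lebesgue_integral_def by (rule integral_mult_right_zero)
    ultimately show "(LINT t:{0<..}|lborel. exp (- q * t) * w t) = Re (F (of_real q))"
      using wedge_transform_laplace(2)[OF c f supp q] by simp
  qed
qed

section \<open>The resolvent and its pole\<close>

text \<open>Equality at two points would force \<open>k = 0\<close> almost everywhere, hence K = 0,
  against the divergence of K at the origin.\<close>

lemma lapK_strict_antimono:
  assumes k: "standing_kernel k" and pq: "0 < p" "p < q"
  shows "lapK k q < lapK k p"
proof -
  have k0: "\<And>t. t > 0 \<Longrightarrow> k t \<ge> 0" using k by (simp add: standing_kernel_def)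
  have int: "integrable lborel (\<lambda>t. indicator {0<..} t * (exp (- x * t) * k t))" if "x > 0" for x
    using k that by (simp add: standing_kernel_def set_integrable_def)
  have lap: "lapK k x = (LINT t|lborel. indicator {0<..} t * (exp (- x * t) * k t))" for x
    by (simp add: lapK_def set_lebesgue_integral_def)
  let ?h = "\<lambda>t. indicator {0<..} t * (exp (- p * t) * k t) - indicator {0<..} t * (exp (- q * t) * k t)"
  have h: "integrable lborel ?h" using int[of p] int[of q] pq by simp
  have nn: "0 \<le> ?h t" for t
    using k0[of t] pq by (auto simp: indicator_def intro!: mult_right_mono)
  have diff: "lapK k p - lapK k q = (LINT t|lborel. ?h t)"
    unfolding lap using int[of p] int[of q] pq by simp
  have "(LINT t|lborel. ?h t) \<noteq> 0"
  proof
    assume "(LINT t|lborel. ?h t) = 0"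
    then have "AE t in lborel. ?h t = 0"
      using integral_nonneg_eq_0_iff_AE[OF h] nn by simp
    then have k0': "AE t in lborel. t > 0 \<longrightarrow> k t = 0"
      by eventually_elim (use pq in \<open>auto simp: indicator_def\<close>)
    have "lapK k x = (LINT t|(lborel :: real measure). 0)" if "x > 0" for x
      unfolding lap
    proof (rule integral_cong_AE)
      show "AE t in lborel. indicator {0<..} t * (exp (- x * t) * k t) = 0"
        using k0' by eventually_elim (auto simp: indicator_def)
    qed (use int[OF that] in auto)
    then have "\<forall>\<^sub>F x in at_right 0. lapK k x = 0"
      by (intro eventually_at_right_less[THEN eventually_mono]) simp
    moreover have "\<forall>\<^sub>F x in at_right 0. lapK k x > 0"
      using k unfolding standing_kernel_def filterlim_at_top_dense by blast
    ultimately have "\<forall>\<^sub>F x in at_right (0::real). False"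
      by eventually_elim simp
    then show False by simp
  qed
  moreover have "0 \<le> (LINT t|lborel. ?h t)" using nn by (intro integral_nonneg_AE) simp
  ultimately show ?thesis using diff by linarith
qed

lemma lapL_continuous_on:
  assumes k: "standing_kernel k"
  shows "continuous_on {0<..} (lapL k)"
proof -
  from standing_kernel_complex_extension[OF k] obtain L where
    L: "L holomorphic_on - \<real>\<^sub>\<le>\<^sub>0" "\<And>x. x > 0 \<Longrightarrow> L (of_real x) = of_real (lapL k x)" by auto
  have "continuous_on (- \<real>\<^sub>\<le>\<^sub>0) L" using L(1) by (rule holomorphic_on_imp_continuous_on)
  then have "continuous_on {0<..} (\<lambda>x. L (of_real x))"
    by (rule continuous_on_compose2) (auto intro!: continuous_intros simp: complex_nonpos_Reals_iff)
  then have "continuous_on {0<..} (\<lambda>x. Re (L (of_real x)))" by (rule continuous_on_Re)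
  then show ?thesis
    by (rule continuous_on_eq) (simp add: L(2))
qed

text \<open>The increment is L q - L p = (q - p) S q, and S is positive on the positive
  axis.\<close>

lemma lapL_strict_mono:
  assumes k: "standing_kernel k" and pq: "0 < p" "p < q"
  shows "lapL k p < lapL k q"
proof -
  from standing_kernel_complex_extension[OF k] obtain L where
    L: "\<And>x. x > 0 \<Longrightarrow> L (of_real x) = of_real (lapL k x)"
    and div: "\<forall>p>0. \<exists>S. S holomorphic_on - \<real>\<^sub>\<le>\<^sub>0 \<and>
      (\<forall>z\<in>- \<real>\<^sub>\<le>\<^sub>0. L z - L (of_real p) = (z - of_real p) * S z \<and> S z \<noteq> 0) \<and>
      (\<forall>x>0. \<exists>y>0. S (of_real x) = of_real y)" by blast
  from div pq obtain S where S: "\<forall>z\<in>- \<real>\<^sub>\<le>\<^sub>0. L z - L (of_real p) = (z - of_real p) * S z"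
    "\<forall>x>0. \<exists>y>0. S (of_real x) = of_real y" by blast
  from S(2) pq obtain y where y: "y > 0" "S (of_real q) = of_real y" by (meson less_trans)
  have "L (of_real q) - L (of_real p) = (of_real q - of_real p) * S (of_real q)"
    using S(1) pq by (simp add: complex_nonpos_Reals_iff)
  then have "of_real (lapL k q - lapL k p) = (of_real ((q - p) * y) :: complex)"
    using pq by (simp add: L y(2))
  then have "lapL k q - lapL k p = (q - p) * y" by (simp only: of_real_eq_iff)
  moreover have "(q - p) * y > 0" using pq y by simp
  ultimately show ?thesis by linarith
qed

lemma lapL_surj:
  assumes k: "standing_kernel k" and a: "a > 0"
  obtains p where "p > 0" "lapL k p = a"
proof -
  have "\<forall>\<^sub>F x in at_right 0. lapL k x < a \<and> x > 0"
    using k a eventually_at_right_less[of "0::real"] unfolding standing_kernel_def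
    by (intro eventually_conj order_tendstoD(2)) auto
  then obtain x1 where x1: "x1 > 0" "lapL k x1 < a"
    using eventually_happens'[OF trivial_limit_at_right_real] by blast
  have "\<forall>\<^sub>F x in at_top. lapL k x > a \<and> x > x1"
    using k eventually_gt_at_top[of x1] unfolding standing_kernel_def filterlim_at_top_dense
    by (intro eventually_conj) auto
  then obtain x2 where x2: "x2 > x1" "lapL k x2 > a"
    using eventually_happens'[OF trivial_limit_at_top_linorder] by blast
  have "continuous_on {x1..x2} (lapL k)"
    using lapL_continuous_on[OF k] by (rule continuous_on_subset) (use x1 in auto)
  from IVT'[of "lapL k" x1 a x2, OF _ _ _ this] x1 x2
  obtain p where "x1 \<le> p" "lapL k p = a" by auto
  then show ?thesis using x1 by (intro that[of p]) auto
qed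

section \<open>Removal of the pole\<close>

text \<open>R is the residue of 1 / (z (L z - a)) at p0, positive because S is. The decay clause
  serves the closing of the contour and the integrability clause the inversion on the ray; the
  latter is where the integral condition on L enters.\<close>

lemma kappa_resolvent_decomposition:
  assumes k: "standing_kernel k"
    and fin: "(\<integral>\<^sup>+ s. ennreal (1 / (s * lapL k s)) * indicator {1..} s \<partial>lborel) < \<infinity>"
    and p0: "p0 > 0" and a: "a > 0" and L0: "lapL k p0 = a"
  shows "\<exists>R F. R > 0 \<and> F holomorphic_on - \<real>\<^sub>\<le>\<^sub>0 \<and> (\<forall>x>0. Im (F (of_real x)) = 0) \<and>
    (\<forall>e>0. \<exists>r0. \<forall>z. Im z \<ge> 0 \<longrightarrow> Re z + Im z \<ge> 0 \<longrightarrow> norm z \<ge> r0 \<longrightarrow> norm (F z) \<le> e) \<and>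
    (\<forall>c>0. set_integrable lborel {0..} (\<lambda>r. F (wedge_ray c r))) \<and>
    (\<forall>q>p0. 1 / (q * (lapL k q - a)) = R * (1 / (q - p0) - 1 / (q + 1)) + Re (F (of_real q)))"
proof -
  from standing_kernel_complex_extension[OF k] obtain L where
    L_hol: "L holomorphic_on - \<real>\<^sub>\<le>\<^sub>0" and
    L: "\<And>x. x > 0 \<Longrightarrow> L (of_real x) = of_real (lapL k x)" and
    wedge: "\<And>z. Im z \<ge> 0 \<Longrightarrow> Re z + Im z \<ge> 0 \<Longrightarrow> z \<noteq> 0 \<Longrightarrow> lapL k (norm z) / 6 \<le> norm (L z)"
    and div: "\<forall>p>0. \<exists>S. S holomorphic_on - \<real>\<^sub>\<le>\<^sub>0 \<and>
      (\<forall>z\<in>- \<real>\<^sub>\<le>\<^sub>0. L z - L (of_real p) = (z - of_real p) * S z \<and> S z \<noteq> 0) \<and>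
      (\<forall>x>0. \<exists>y>0. S (of_real x) = of_real y)" by blast
  from div p0 obtain S where S_hol: "S holomorphic_on - \<real>\<^sub>\<le>\<^sub>0" and
    S: "\<And>z. z \<notin> \<real>\<^sub>\<le>\<^sub>0 \<Longrightarrow> L z - of_real a = (z - of_real p0) * S z" "\<And>z. z \<notin> \<real>\<^sub>\<le>\<^sub>0 \<Longrightarrow> S z \<noteq> 0"
    and S_real: "\<And>x. x > 0 \<Longrightarrow> \<exists>y>0. S (of_real x) = of_real y"
    using L[OF p0] L0 by (metis ComplI)
  have slit: "of_real x \<notin> (\<real>\<^sub>\<le>\<^sub>0 :: complex set)" if "x > 0" for x :: real
    using that by (simp add: complex_nonpos_Reals_iff)
  have nz: "z \<noteq> 0" "z + 1 \<noteq> 0" if "z \<notin> \<real>\<^sub>\<le>\<^sub>0" for z :: complex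
    using that by (auto simp: complex_nonpos_Reals_iff complex_eq_iff)
  \<comment> \<open>Chosen so that N z / ((z + 1) (z - p0)) = 1 / (z (L z - a)). Subtracting the
    value of N at p0 from the numerator removes the pole by a term of order 1/|z|^2.\<close>
  define N where "N z = (z + 1) / (z * S z)" for z
  have N_hol: "N holomorphic_on - \<real>\<^sub>\<le>\<^sub>0"
    unfolding N_def[abs_def] using nz S(2) by (intro holomorphic_intros S_hol) auto
  have N_real: "\<exists>y>0. N (of_real x) = of_real y" if x: "x > 0" for x
  proof -
    from S_real[OF x] obtain y where "y > 0" "S (of_real x) = of_real y" by blast
    then show ?thesis using x
      by (intro exI[of _ "(x + 1) / (x * y)"]) (simp add: N_def)
  qed
  from N_real[OF p0] obtain N0 where N0: "N0 > 0" "N (of_real p0) = of_real N0" by blast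
  obtain Q where Q: "Q holomorphic_on - \<real>\<^sub>\<le>\<^sub>0" "\<And>z. N z - of_real N0 = (z - of_real p0) * Q z"
    "\<And>x. x > 0 \<Longrightarrow> Im (Q (of_real x)) = 0"
  proof (rule slit_plane_difference_quotient[OF N_hol _ p0])
    show "Im (N (of_real x)) = 0" if "x > 0" for x
      using N_real[OF that] by auto
  qed (use N0(2) in auto)
  define F where "F z = Q z / (z + 1)" for z
  have F_hol: "F holomorphic_on - \<real>\<^sub>\<le>\<^sub>0"
    unfolding F_def[abs_def] using nz by (intro holomorphic_intros Q(1)) auto
  have F_real: "Im (F (of_real x)) = 0" if "x > 0" for x
  proof -
    have "Im (Q (of_real x) / of_real (x + 1)) = 0"
      using Q(3)[OF that] by (simp only: Im_divide_of_real)
    then show ?thesis by (simp add: F_def)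
  qed
  have F_eq: "F z = 1 / (z * (L z - of_real a)) - of_real N0 / ((z + 1) * (z - of_real p0))"
    if z: "z \<notin> \<real>\<^sub>\<le>\<^sub>0" "z \<noteq> of_real p0" for z
  proof -
    have "F z = (N z - of_real N0) / ((z + 1) * (z - of_real p0))"
      unfolding Q(2) F_def using z by simp
    also have "\<dots> = N z / ((z + 1) * (z - of_real p0)) - of_real N0 / ((z + 1) * (z - of_real p0))"
      by (rule diff_divide_distrib)
    also have "N z / ((z + 1) * (z - of_real p0)) = 1 / (z * (L z - of_real a))"
      unfolding N_def S(1)[OF z(1)] using nz[OF z(1)] z S(2)[OF z(1)] by simp
    finally show ?thesis .
  qed
  \<comment> \<open>The sector bound gives |L| at least \<open>lapL / 6\<close>; from 12 a on,
    subtracting a costs at most half of it, so |L - a| is at least \<open>lapL / 12\<close>. The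
    bound 2 p0 + 2 in \<open>r2\<close> makes |z + 1| and |z - p0| at least |z| / 2.\<close>
  have "\<forall>\<^sub>F x in at_top. lapL k x \<ge> 12 * a"
    using k unfolding standing_kernel_def filterlim_at_top by blast
  then obtain r1 where r1: "\<And>x. x \<ge> r1 \<Longrightarrow> lapL k x \<ge> 12 * a"
    by (auto simp: eventually_at_top_linorder)
  define r2 where "r2 = max r1 (2 * p0 + 2)"
  have r2: "r2 \<ge> 2" using p0 by (simp add: r2_def)
  have F_bound: "norm (F z) \<le> 12 / (norm z * lapL k (norm z)) + 4 * N0 / (norm z)\<^sup>2"
    if z: "Im z \<ge> 0" "Re z + Im z \<ge> 0" "norm z \<ge> r2" for z
  proof -
    have n: "norm z \<ge> r1" "norm z \<ge> 2 * p0 + 2" using z(3) by (auto simp: r2_def)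
    then have z0: "z \<noteq> 0" using p0 by auto
    then have zs: "z \<notin> \<real>\<^sub>\<le>\<^sub>0" using z by (auto simp: complex_nonpos_Reals_iff complex_eq_iff)
    have lz: "lapL k (norm z) \<ge> 12 * a" using r1 n by blast
    have l: "lapL k (norm z) / 12 \<le> norm (L z - of_real a)"
      using norm_triangle_ineq2[of "L z" "of_real a"] wedge[OF z(1,2) z0] lz a by simp
    have n1: "norm z / 2 \<le> norm (z + 1)"
      using norm_triangle_ineq2[of z "- 1"] n p0 by simp
    have n2: "norm z / 2 \<le> norm (z - of_real p0)"
      using norm_triangle_ineq2[of z "of_real p0"] n p0 by simp
    have "z \<noteq> of_real p0" using n2 z0 by auto
    then have "norm (F z) \<le> norm (1 / (z * (L z - of_real a))) + norm (of_real N0 / ((z + 1) * (z - of_real p0)))"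
      unfolding F_eq[OF zs \<open>z \<noteq> of_real p0\<close>] by (intro norm_triangle_ineq4)
    also have "norm (1 / (z * (L z - of_real a))) \<le> 1 / (norm z * (lapL k (norm z) / 12))"
      unfolding norm_divide norm_mult using l lz a z0
      by (intro frac_le mult_left_mono) (auto intro!: mult_pos_pos)
    also have "norm (of_real N0 / ((z + 1) * (z - of_real p0))) \<le> N0 / ((norm z / 2) * (norm z / 2))"
      unfolding norm_divide norm_mult using n1 n2 z0 N0(1)
      by (intro frac_le mult_mono) (auto intro!: mult_pos_pos)
    finally show ?thesis by (simp add: power2_eq_square mult_ac)
  qed
  show ?thesis
  proof (rule exI[of _ "N0 / (p0 + 1)"], rule exI[of _ F], intro conjI allI impI)
    show "N0 / (p0 + 1) > 0" using N0 p0 by simp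
    show "F holomorphic_on - \<real>\<^sub>\<le>\<^sub>0" by (rule F_hol)
    show "Im (F (of_real x)) = 0" if "x > 0" for x by (rule F_real[OF that])
  next
    fix e :: real assume e: "e > 0"
    have "\<forall>\<^sub>F r in at_top. 1 / (a * r) + 4 * N0 / r\<^sup>2 < e"
      using e a by real_asymp
    then obtain r3 where r3: "\<And>r. r \<ge> r3 \<Longrightarrow> 1 / (a * r) + 4 * N0 / r\<^sup>2 < e"
      by (auto simp: eventually_at_top_linorder)
    have "norm (F z) \<le> e" if z: "Im z \<ge> 0" "Re z + Im z \<ge> 0" "norm z \<ge> max r2 r3" for z
    proof -
      have z2: "norm z \<ge> r2" "norm z \<ge> r1" "norm z \<ge> r3" using z(3) by (auto simp: r2_def)
      have "12 / (norm z * lapL k (norm z)) \<le> 12 / (norm z * (12 * a))"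
        using r1[OF z2(2)] a z2(1) r2 by (intro divide_left_mono mult_left_mono) (auto intro!: mult_pos_pos)
      also have "\<dots> = 1 / (a * norm z)" by simp
      finally show ?thesis using F_bound[OF z(1,2) z2(1)] r3[OF z2(3)] by linarith
    qed
    then show "\<exists>r0. \<forall>z. Im z \<ge> 0 \<longrightarrow> Re z + Im z \<ge> 0 \<longrightarrow> norm z \<ge> r0 \<longrightarrow> norm (F z) \<le> e" by blast
  next
    fix c :: real assume c: "c > 0"
    let ?G = "\<lambda>r. F (wedge_ray c r)"
    have ray: "continuous_on {0..} (wedge_ray c)"
      using wedge_ray_derivative by (intro continuous_on_vector_derivative) blast
    have cont: "continuous_on {0..} ?G"
      by (rule continuous_on_compose2[OF holomorphic_on_imp_continuous_on[OF F_hol] ray])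
         (use c wedge_ray_not_nonpos in auto)
    have "set_integrable lborel {0..r2} ?G"
      unfolding set_integrable_def
      by (rule borel_integrable_compact) (auto intro: continuous_on_subset[OF cont])
    moreover have "set_integrable lborel {r2..} ?G"
    proof (rule set_integrable_bound)
      have pos: "lapL k r > 0" if "r \<ge> r2" for r
        using r1[of r] that a by (auto simp: r2_def)
      have meas: "(\<lambda>r. indicator {r2..} r *\<^sub>R (1 / (r * lapL k r))) \<in> borel_measurable lborel"
      proof -
        have "continuous_on {r2..} (\<lambda>r. 1 / (r * lapL k r))"
          using pos r2 by (intro continuous_intros continuous_on_subset[OF lapL_continuous_on[OF k]]) force+
        from borel_measurable_continuous_on_indicator[OF _ this] show ?thesis by simp
      qed
      have i1: "set_integrable lborel {r2..} (\<lambda>r. 1 / (r * lapL k r))"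
        unfolding set_integrable_def
      proof (rule integrableI_bounded[OF meas])
        have "(\<integral>\<^sup>+ r. ennreal (norm (indicator {r2..} r *\<^sub>R (1 / (r * lapL k r)))) \<partial>lborel) \<le>
            (\<integral>\<^sup>+ s. ennreal (1 / (s * lapL k s)) * indicator {1..} s \<partial>lborel)"
          using pos r2 by (intro nn_integral_mono) (auto simp: indicator_def less_imp_le)
        then show "(\<integral>\<^sup>+ r. ennreal (norm (indicator {r2..} r *\<^sub>R (1 / (r * lapL k r)))) \<partial>lborel) < \<infinity>"
          using fin by (rule le_less_trans)
      qed
      have i2: "set_integrable lborel {r2..} (\<lambda>r. 1 / r\<^sup>2)"
        unfolding set_integrable_def
      proof (rule integrableI_bounded)
        have "(\<integral>\<^sup>+ r. ennreal (norm (indicator {r2..} r *\<^sub>R (1 / r\<^sup>2))) \<partial>lborel) =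
            (\<integral>\<^sup>+ r. ennreal (1 / r\<^sup>2) * indicator {r2..} r \<partial>lborel)"
          by (intro nn_integral_cong) (auto simp: indicator_def)
        also have "\<dots> = ennreal (0 - (- 1 / r2))"
        proof (rule nn_integral_FTC_atLeast)
          show "((\<lambda>r. - 1 / r) \<longlongrightarrow> (0::real)) at_top" by real_asymp
          show "((\<lambda>r. - 1 / r) has_real_derivative 1 / r\<^sup>2) (at r)" if "r2 \<le> r" for r
            using that r2 by (auto intro!: derivative_eq_intros simp: power2_eq_square)
        qed auto
        finally show "(\<integral>\<^sup>+ r. ennreal (norm (indicator {r2..} r *\<^sub>R (1 / r\<^sup>2))) \<partial>lborel) < \<infinity>" by simp
      qed measurable
      show "set_integrable lborel {r2..} (\<lambda>r. 12 * (1 / (r * lapL k r)) + 4 * N0 * (1 / r\<^sup>2))"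
        by (intro set_integral_add set_integrable_mult_right i1 i2)
      show "set_borel_measurable lborel {r2..} ?G"
        unfolding set_borel_measurable_def using r2
        by (auto intro!: borel_measurable_continuous_on_indicator continuous_on_subset[OF cont])
      show "AE r in lborel. r \<in> {r2..} \<longrightarrow> norm (?G r) \<le> norm (12 * (1 / (r * lapL k r)) + 4 * N0 * (1 / r\<^sup>2))"
      proof (intro always_eventually allI impI)
        fix r assume "r \<in> {r2..}"
        then have r: "r \<ge> r2" "r > 0" using r2 by auto
        let ?z = "wedge_ray c r"
        have rz: "r \<le> norm ?z" using abs_Im_le_cmod[of ?z] r by simp
        \<comment> \<open>The bound on F is in terms of |z|, the hypothesis in terms of the
          parameter r. Since r is the imaginary part of the point, |z| is at least r, and
          monotonicity of L allows the exchange.\<close>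
        have l: "lapL k r \<le> lapL k (norm ?z)"
          using lapL_strict_mono[OF k r(2), of "norm ?z"] rz by (cases "r = norm ?z") auto
        have "norm (?G r) \<le> 12 / (norm ?z * lapL k (norm ?z)) + 4 * N0 / (norm ?z)\<^sup>2"
          using r rz c by (intro F_bound) auto
        also have "\<dots> \<le> 12 / (r * lapL k r) + 4 * N0 / r\<^sup>2"
          using r rz l pos[OF r(1)] N0(1)
          by (intro add_mono divide_left_mono mult_mono power_mono) (auto intro!: mult_pos_pos)
        finally show "norm (?G r) \<le> norm (12 * (1 / (r * lapL k r)) + 4 * N0 * (1 / r\<^sup>2))" by simp
      qed
    qed
    ultimately have "set_integrable lborel ({0..r2} \<union> {r2..}) ?G"
      by (rule set_integrable_Un) auto
    moreover have "{0..r2} \<union> {r2..} = {0..}" using r2 by auto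
    ultimately show "set_integrable lborel {0..} ?G" by simp
  next
    fix q assume q: "q > p0"
    have "Re (F (of_real q)) = Re (of_real (1 / (q * (lapL k q - a)) - N0 / ((q + 1) * (q - p0))))"
      using q p0 by (subst F_eq[OF slit]) (simp_all add: L)
    then have "Re (F (of_real q)) = 1 / (q * (lapL k q - a)) - N0 / ((q + 1) * (q - p0))"
      by (simp only: Re_complex_of_real)
    moreover have "N0 / ((q + 1) * (q - p0)) = N0 / (p0 + 1) * (1 / (q - p0) - 1 / (q + 1))"
      using q p0 by (simp add: divide_simps)
    ultimately show "1 / (q * (lapL k q - a)) = N0 / (p0 + 1) * (1 / (q - p0) - 1 / (q + 1)) + Re (F (of_real q))"
      by simp
  qed
qed

section \<open>Asymptotics and intermittency\<close>

lemma exp_laplace_Ioi: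
  fixes b q :: real
  assumes "b < q"
  shows "set_integrable lborel {0<..} (\<lambda>t. exp (- q * t) * exp (b * t))"
    and "(LINT t:{0<..}|lborel. exp (- q * t) * exp (b * t)) = 1 / (q - b)"
proof -
  have "has_bochner_integral lborel (\<lambda>t. indicator {0<..} t *\<^sub>R (exp (- q * t) * exp (b * t))) (1 / (q - b))"
  proof (rule has_bochner_integral_nn_integral)
    have "(\<integral>\<^sup>+ t. ennreal (indicator {0<..} t *\<^sub>R (exp (- q * t) * exp (b * t))) \<partial>lborel) =
        (\<integral>\<^sup>+ t. ennreal (exp (- (q - b) * t)) * indicator {0<..} t \<partial>lborel)"
      by (intro nn_integral_cong) (auto simp: indicator_def exp_add[symmetric] algebra_simps)
    then show "(\<integral>\<^sup>+ t. ennreal (indicator {0<..} t *\<^sub>R (exp (- q * t) * exp (b * t))) \<partial>lborel) = ennreal (1 / (q - b))"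
      using assms by (simp only: nn_integral_exp_Ioi diff_gt_0_iff_gt)
  qed (use assms in auto)
  then show "set_integrable lborel {0<..} (\<lambda>t. exp (- q * t) * exp (b * t))"
    and "(LINT t:{0<..}|lborel. exp (- q * t) * exp (b * t)) = 1 / (q - b)"
    unfolding set_integrable_def set_lebesgue_integral_def
    by (auto simp: has_bochner_integral_iff)
qed

text \<open>The n-th moment grows like C times \<open>exp (p0 t)\<close>, where C is
  \<open>n * \<beta>\<close> times the residue. Strict positivity of C is what later permits
  division by these asymptotics.\<close>

lemma kappa_asymptotics:
  assumes k: "standing_kernel k" and \<mu>: "subordinator_laws k \<mu>"
    and fin: "(\<integral>\<^sup>+ s. ennreal (1 / (s * lapL k s)) * indicator {1..} s \<partial>lborel) < \<infinity>"
    and \<beta>: "\<beta> > 0" and n: "n \<ge> 1" and p0: "p0 > 0" "lapL k p0 = real n * \<beta>"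
  obtains f C where "real_analytic_on f {0<..}"
    "AE t in lborel. t > 0 \<longrightarrow> kappa k \<mu> \<beta> n t = ennreal (f t)"
    "C > 0" "((\<lambda>t. f t * exp (- p0 * t)) \<longlongrightarrow> C) at_top"
proof -
  define a where "a = real n * \<beta>"
  have a: "a > 0" using n \<beta> by (simp add: a_def)
  have L0: "lapL k p0 = a" using p0 by (simp add: a_def)
  obtain R F where R: "R > 0" and F: "F holomorphic_on - \<real>\<^sub>\<le>\<^sub>0" "\<forall>x>0. Im (F (of_real x)) = 0"
    "\<forall>e>0. \<exists>r0. \<forall>z. Im z \<ge> 0 \<longrightarrow> Re z + Im z \<ge> 0 \<longrightarrow> norm z \<ge> r0 \<longrightarrow> norm (F z) \<le> e"
    "\<forall>c>0. set_integrable lborel {0..} (\<lambda>r. F (wedge_ray c r))"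
    and F_eq: "\<forall>q>p0. 1 / (q * (lapL k q - a)) = R * (1 / (q - p0) - 1 / (q + 1)) + Re (F (of_real q))"
    using kappa_resolvent_decomposition[OF k fin p0(1) a L0] by (elim exE conjE) (rule that)
  \<comment> \<open>Any value strictly between 0 and p0 would serve; the midpoint makes c - p0 = -
    c, the decay rate of the remainder after normalisation.\<close>
  define c where "c = p0 / 2"
  have c: "c > 0" "c < p0" using p0 by (auto simp: c_def)
  have "\<exists>w D. real_analytic_on w {0<..} \<and> (\<forall>t\<ge>0. \<bar>w t\<bar> \<le> D * exp (c * t)) \<and>
    (\<forall>q>c. set_integrable lborel {0<..} (\<lambda>t. exp (- q * t) * w t) \<and>
      (LINT t:{0<..}|lborel. exp (- q * t) * w t) = Re (F (of_real q)))"
    by (rule wedge_laplace_inversion[OF c(1) F(1) F(2)[rule_format] F(3)[rule_format] F(4)[rule_format, OF c(1)]])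
  then obtain w D where w: "real_analytic_on w {0<..}" "\<forall>t\<ge>0. \<bar>w t\<bar> \<le> D * exp (c * t)"
    and w_laplace: "\<forall>q>c. set_integrable lborel {0<..} (\<lambda>t. exp (- q * t) * w t) \<and>
      (LINT t:{0<..}|lborel. exp (- q * t) * w t) = Re (F (of_real q))"
    by (elim exE conjE) (rule that)
  \<comment> \<open>This is \<open>1 + a R exp (p0 t) - a R exp (- t) + a w\<close>, with trivial
    factors inserted so that it is literally a nested linear combination of exponentials and
    \<open>w\<close>.\<close>
  define f where "f t = 1 * (1 * exp (0 * t) + a * R * exp (p0 * t)) + 1 * ((- a * R) * exp (- 1 * t) + a * w t)" for t
  have f_analytic: "real_analytic_on f {0<..}"
    unfolding f_def[abs_def] by (intro real_analytic_on_linear_combination real_analytic_on_exp w(1))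
  have f_laplace: "set_integrable lborel {0<..} (\<lambda>t. exp (- q * t) * f t) \<and>
      (LINT t:{0<..}|lborel. exp (- q * t) * f t) = lapK k q / (lapL k q - a)" if q: "q > p0" for q
  proof -
    have q0: "q > 0" "q > c" using q c by auto
    note wq = w_laplace[rule_format, OF q0(2)]
    note e1 = exp_laplace_Ioi[of 0 q] and e2 = exp_laplace_Ioi[of p0 q] and e3 = exp_laplace_Ioi[of "- 1" q]
    have eq: "exp (- q * t) * f t = (exp (- q * t) * exp (0 * t) + a * R * (exp (- q * t) * exp (p0 * t))) +
        ((- a * R) * (exp (- q * t) * exp (- 1 * t)) + a * (exp (- q * t) * w t))" for t
      by (simp add: f_def algebra_simps)
    have i1: "set_integrable lborel {0<..} (\<lambda>t. exp (- q * t) * exp (0 * t))"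
      and i2: "set_integrable lborel {0<..} (\<lambda>t. a * R * (exp (- q * t) * exp (p0 * t)))"
      and i3: "set_integrable lborel {0<..} (\<lambda>t. (- a * R) * (exp (- q * t) * exp (- 1 * t)))"
      and i4: "set_integrable lborel {0<..} (\<lambda>t. a * (exp (- q * t) * w t))"
      using q q0 by (intro set_integrable_mult_right e1(1) e2(1) e3(1) wq[THEN conjunct1]; simp)+
    have int: "set_integrable lborel {0<..} (\<lambda>t. exp (- q * t) * f t)"
      unfolding eq by (intro set_integral_add i1 i2 i3 i4)
    have "(LINT t:{0<..}|lborel. exp (- q * t) * f t) =
        1 / (q - 0) + a * R * (1 / (q - p0)) + ((- a * R) * (1 / (q - - 1)) + a * Re (F (of_real q)))"
      unfolding eq using e1(2) e2(2) e3(2) wq[THEN conjunct2] q q0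
      by (simp only: set_integral_add(2) set_integral_add(1) i1 i2 i3 i4 set_integral_mult_right)
    also have "\<dots> = 1 / q + a * (R * (1 / (q - p0) - 1 / (q + 1)) + Re (F (of_real q)))"
      by (simp add: algebra_simps)
    also have "\<dots> = 1 / q + a * (1 / (q * (lapL k q - a)))"
      unfolding F_eq[rule_format, OF q] ..
    also have "\<dots> = lapK k q / (lapL k q - a)"
    proof -
      have "lapL k q - a > 0" using lapL_strict_mono[OF k p0(1) q] L0 by simp
      moreover have "lapK k q = lapL k q / q" using q0 by (simp add: lapL_def)
      ultimately show ?thesis using q0 by (simp add: divide_simps)
    qed
    finally show ?thesis using int by simp
  qed
  note [measurable] = kappa_measurable[OF k \<mu>, of \<beta> n]
  define g where "g t = enn2real (kappa k \<mu> \<beta> n t)" for t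
  have [measurable]: "g \<in> borel_measurable borel" unfolding g_def[abs_def] by measurable
  have lap: "(\<integral>\<^sup>+ t. ennreal (exp (- q * t)) * kappa k \<mu> \<beta> n t * indicator {0<..} t \<partial>lborel) =
      ennreal (lapK k q / (lapL k q - a))" and pos: "lapK k q / (lapL k q - a) \<ge> 0" if q: "q > p0" for q
  proof -
    have l: "lapL k q > a" using lapL_strict_mono[OF k p0(1) q] L0 by simp
    then show "(\<integral>\<^sup>+ t. ennreal (exp (- q * t)) * kappa k \<mu> \<beta> n t * indicator {0<..} t \<partial>lborel) =
      ennreal (lapK k q / (lapL k q - a))"
      using kappa_laplace[OF k \<mu>, of q n \<beta>] q p0 by (simp add: a_def)
    have "lapL k q > 0" using l a by simp
    then have "lapK k q > 0" using q p0 by (simp add: lapL_def zero_less_mult_iff)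
    then show "lapK k q / (lapL k q - a) \<ge> 0" using l by simp
  qed
  \<comment> \<open>A finite transform at one point, here p0 + 1, already gives finiteness almost
    everywhere.\<close>
  have kfin: "AE t in lborel. t > 0 \<longrightarrow> kappa k \<mu> \<beta> n t = ennreal (g t)"
  proof -
    let ?q = "p0 + 1"
    have "AE t in lborel. ennreal (exp (- ?q * t)) * kappa k \<mu> \<beta> n t * indicator {0<..} t \<noteq> \<infinity>"
    proof (rule nn_integral_PInf_AE)
      show "(\<lambda>t. ennreal (exp (- ?q * t)) * kappa k \<mu> \<beta> n t * indicator {0<..} t) \<in> borel_measurable lborel"
        by measurable
      show "(\<integral>\<^sup>+ t. ennreal (exp (- ?q * t)) * kappa k \<mu> \<beta> n t * indicator {0<..} t \<partial>lborel) \<noteq> \<infinity>"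
        unfolding lap[of ?q, OF less_add_one] by simp
    qed
    then show ?thesis
    proof eventually_elim
      case (elim t)
      show ?case
      proof
        assume "t > 0"
        with elim have "kappa k \<mu> \<beta> n t \<noteq> \<infinity>"
          by (auto simp: ennreal_mult_top)
        then show "kappa k \<mu> \<beta> n t = ennreal (g t)"
          by (simp add: g_def less_top)
      qed
    qed
  qed
  have g_laplace: "has_bochner_integral lborel (\<lambda>t. indicator {0<..} t *\<^sub>R (exp (- q * t) * g t)) (lapK k q / (lapL k q - a))"
    if q: "q > p0" for q
  proof (rule has_bochner_integral_nn_integral)
    have "(\<integral>\<^sup>+ t. ennreal (indicator {0<..} t *\<^sub>R (exp (- q * t) * g t)) \<partial>lborel) =
       (\<integral>\<^sup>+ t. ennreal (exp (- q * t)) * kappa k \<mu> \<beta> n t * indicator {0<..} t \<partial>lborel)"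
    proof (rule nn_integral_cong_AE)
      show "AE t in lborel. ennreal (indicator {0<..} t *\<^sub>R (exp (- q * t) * g t)) =
          ennreal (exp (- q * t)) * kappa k \<mu> \<beta> n t * indicator {0<..} t"
        using kfin by eventually_elim (auto simp: indicator_def ennreal_mult')
    qed
    then show "(\<integral>\<^sup>+ t. ennreal (indicator {0<..} t *\<^sub>R (exp (- q * t) * g t)) \<partial>lborel) = ennreal (lapK k q / (lapL k q - a))"
      using lap[OF q] by simp
  qed (use pos[OF q] in \<open>auto simp: g_def\<close>)
  \<comment> \<open>The weight shifts the integer nodes m = 0, 1, 2, ... to p0 + 1 + m, all in the
    range where both transforms are known; it also makes the difference integrable.\<close>
  have "AE t in lborel. t > 0 \<longrightarrow> exp (- (p0 + 1) * t) * (g t - f t) = 0"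
  proof (rule laplace_zero_imp_AE_zero)
    have main: "has_bochner_integral lborel (\<lambda>t. indicator {0<..} t *\<^sub>R (exp (- q * t) * (g t - f t))) 0" if q: "q > p0" for q
    proof -
      have "has_bochner_integral lborel (\<lambda>t. indicator {0<..} t *\<^sub>R (exp (- q * t) * f t)) (lapK k q / (lapL k q - a))"
        using f_laplace[OF q] unfolding set_integrable_def set_lebesgue_integral_def has_bochner_integral_iff .
      from has_bochner_integral_diff[OF g_laplace[OF q] this] show ?thesis
        by (simp add: right_diff_distrib)
    qed
    show "set_integrable lborel {0<..} (\<lambda>t. exp (- (p0 + 1) * t) * (g t - f t))"
      using main[of "p0 + 1"] by (simp add: set_integrable_def has_bochner_integral_iff)
    fix m :: nat
    have eq: "exp (- real m * t) * (exp (- (p0 + 1) * t) * (g t - f t)) = exp (- (p0 + 1 + real m) * t) * (g t - f t)" for t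
    proof -
      have "exp (- real m * t) * exp (- (p0 + 1) * t) = exp (- (p0 + 1 + real m) * t)"
        by (simp add: exp_add[symmetric] algebra_simps)
      then show ?thesis by (simp only: mult.assoc[symmetric])
    qed
    have "p0 + 1 + real m > p0" by simp
    from main[OF this]
    show "(LINT t:{0<..}|lborel. exp (- real m * t) * (exp (- (p0 + 1) * t) * (g t - f t))) = 0"
      unfolding set_lebesgue_integral_def eq has_bochner_integral_iff by (rule conjunct2)
  qed
  with kfin have AE: "AE t in lborel. t > 0 \<longrightarrow> kappa k \<mu> \<beta> n t = ennreal (f t)"
    by eventually_elim auto
  have "((\<lambda>t. exp (- p0 * t) + a * R - a * R * exp (- (1 + p0) * t) + a * (w t * exp (- p0 * t))) \<longlongrightarrow> 0 + a * R - a * R * 0 + a * 0) at_top"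
  proof (intro tendsto_intros)
    show "((\<lambda>t. exp (- p0 * t)) \<longlongrightarrow> 0) at_top" "((\<lambda>t. exp (- (1 + p0) * t)) \<longlongrightarrow> 0) at_top"
      using p0(1) by real_asymp+
    show "((\<lambda>t. w t * exp (- p0 * t)) \<longlongrightarrow> 0) at_top"
    proof (rule Lim_null_comparison)
      show "\<forall>\<^sub>F t in at_top. norm (w t * exp (- p0 * t)) \<le> D * exp (- c * t)"
        using eventually_ge_at_top[of 0]
      proof eventually_elim
        case (elim t)
        have "norm (w t * exp (- p0 * t)) \<le> D * exp (c * t) * exp (- p0 * t)"
          using w(2)[rule_format, OF elim] by (simp add: abs_mult mult_right_mono)
        also have "\<dots> = D * exp (- c * t)"
          by (simp add: mult.assoc exp_add[symmetric] c_def algebra_simps)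
        finally show ?case .
      qed
      show "((\<lambda>t. D * exp (- c * t)) \<longlongrightarrow> 0) at_top"
        using c(1) by real_asymp
    qed
  qed
  moreover have "exp (- p0 * t) + a * R - a * R * exp (- (1 + p0) * t) + a * (w t * exp (- p0 * t)) = f t * exp (- p0 * t)" for t
  proof -
    have "exp (- (1 + p0) * t) = exp (- t) * exp (- p0 * t)" "exp (p0 * t) * exp (- p0 * t) = 1"
      by (simp_all add: exp_add[symmetric] algebra_simps)
    then show ?thesis by (simp add: f_def algebra_simps)
  qed
  ultimately have "((\<lambda>t. f t * exp (- p0 * t)) \<longlongrightarrow> a * R) at_top" by simp
  then show ?thesis using a R by (intro that[OF f_analytic AE, of "a * R"]) auto
qed

section \<open>Superadditivity of the exponents and intermittency\<close>

lemma prod_list_exp_asymptotics: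
  fixes f :: "nat \<Rightarrow> real \<Rightarrow> real" and p C :: "nat \<Rightarrow> real"
  assumes "\<And>m. m \<in> set ms \<Longrightarrow> ((\<lambda>t. f m t * exp (- p m * t)) \<longlongrightarrow> C m) at_top"
  shows "((\<lambda>t. prod_list (map (\<lambda>m. f m t) ms) * exp (- sum_list (map p ms) * t)) \<longlongrightarrow> prod_list (map C ms)) at_top"
  using assms
proof (induction ms)
  case (Cons m ms)
  have "((\<lambda>t. (f m t * exp (- p m * t)) * (prod_list (map (\<lambda>m. f m t) ms) * exp (- sum_list (map p ms) * t)))
      \<longlongrightarrow> C m * prod_list (map C ms)) at_top"
    using Cons by (intro tendsto_mult) auto
  moreover have "(f m t * exp (- p m * t)) * (prod_list (map (\<lambda>m. f m t) ms) * exp (- sum_list (map p ms) * t)) =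
      prod_list (map (\<lambda>m. f m t) (m # ms)) * exp (- sum_list (map p (m # ms)) * t)" for t
  proof -
    have "exp (- sum_list (map p (m # ms)) * t) = exp (- p m * t) * exp (- sum_list (map p ms) * t)"
      by (simp add: exp_add[symmetric] algebra_simps)
    then show ?thesis by (simp only: list.map prod_list.Cons mult_ac)
  qed
  ultimately show ?case by (simp only: list.map prod_list.Cons)
qed simp

text \<open>With s the sum of the \<open>p m\<close>, L s = s K s splits as the sum of
  \<open>p m * K s\<close>. Two positive summands at least make each \<open>p m\<close> smaller than
  s, so every term is below \<open>p m * K (p m) = m \<beta>\<close>. Hence L s is below
  \<open>L (p n)\<close> with n the sum of the m, and monotonicity of L concludes.\<close>

lemma exponents_strictly_superadditive:
  fixes p :: "nat \<Rightarrow> real"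
  assumes k: "standing_kernel k"
    and p: "\<And>m. m \<ge> 1 \<Longrightarrow> p m > 0" "\<And>m. m \<ge> 1 \<Longrightarrow> lapL k (p m) = real m * \<beta>"
    and ms: "length ms \<ge> 2" "\<forall>m\<in>set ms. m \<ge> 1"
  shows "sum_list (map p ms) < p (sum_list ms)"
proof -
  define s where "s = sum_list (map p ms)"
  have ne: "ms \<noteq> []" using ms by auto
  have pos_sum: "0 < sum_list (map p xs)" if "xs \<noteq> []" "\<forall>m\<in>set xs. m \<ge> 1" for xs
    using sum_list_strict_mono[of xs "\<lambda>_. 0" p] that p(1) by simp
  have s: "s > 0" unfolding s_def using pos_sum[OF ne ms(2)] .
  have less: "p m < s" if m: "m \<in> set ms" for m
  proof -
    from split_list[OF m] obtain as bs where ab: "ms = as @ m # bs" by blast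
    have "as @ bs \<noteq> []" using ms(1) unfolding ab by auto
    then have "0 < sum_list (map p (as @ bs))" using ms(2) by (intro pos_sum) (auto simp: ab)
    then show ?thesis by (simp add: s_def ab)
  qed
  have "lapL k s = (\<Sum>m\<leftarrow>ms. p m * lapK k s)"
    by (simp add: lapL_def s_def sum_list_mult_const)
  also have "\<dots> < (\<Sum>m\<leftarrow>ms. p m * lapK k (p m))"
    using ms(2) p(1) less by (intro sum_list_strict_mono ne mult_strict_left_mono lapK_strict_antimono[OF k]) auto
  also have "\<dots> = (\<Sum>m\<leftarrow>ms. real m * \<beta>)"
    using p(2) ms(2) by (intro arg_cong[of _ _ sum_list] map_cong) (auto simp: lapL_def)
  also have "\<dots> = real (sum_list ms) * \<beta>"
    by (induction ms) (simp_all add: algebra_simps)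
  also have "\<dots> = lapL k (p (sum_list ms))"
  proof -
    have "sum_list ms \<ge> 1" using ne ms(2) by (cases ms) auto
    then show ?thesis by (simp add: p(2))
  qed
  finally have lt: "lapL k s < lapL k (p (sum_list ms))" .
  have "sum_list ms \<ge> 1" using ne ms(2) by (cases ms) auto
  then have "p (sum_list ms) > 0" by (rule p(1))
  then show ?thesis
    using lt lapL_strict_mono[OF k, of "p (sum_list ms)" s] unfolding s_def[symmetric]
    by (cases "s < p (sum_list ms)"; cases "s = p (sum_list ms)") auto
qed

theorem theorem4p1:
  fixes k :: "real \<Rightarrow> real" and \<mu> :: "real \<Rightarrow> real measure" and \<beta> :: real
  assumes "standing_kernel k"
    and "subordinator_laws k \<mu>"
    and "(\<integral>\<^sup>+ s. ennreal (1 / (s * lapL k s)) * indicator {1..} s \<partial>lborel) < \<infinity>"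
    and "\<beta> > 0"
  shows "(\<forall>n\<ge>1. AE t in lborel. t > 0 \<longrightarrow> kappa k \<mu> \<beta> n t < \<infinity>)
    \<and> (\<forall>n\<ge>1. \<exists>f. real_analytic_on f {0<..} \<and>
                  (AE t in lborel. t > 0 \<longrightarrow> kappa k \<mu> \<beta> n t = ennreal (f t)))
    \<and> (\<forall>f :: nat \<Rightarrow> real \<Rightarrow> real.
         (\<forall>n\<ge>1. real_analytic_on (f n) {0<..} \<and>
                 (AE t in lborel. t > 0 \<longrightarrow> kappa k \<mu> \<beta> n t = ennreal (f n t))) \<longrightarrow>
         (\<forall>n ms. n > 1 \<longrightarrow> length ms \<ge> 2 \<longrightarrow> (\<forall>m\<in>set ms. m \<ge> 1) \<longrightarrow> sum_list ms = n \<longrightarrow>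
            filterlim (\<lambda>t. f n t / prod_list (map (\<lambda>m. f m t) ms)) at_top at_top))"
proof -
  have "\<exists>p>0. lapL k p = real n * \<beta>" if "n \<ge> 1" for n
  proof -
    have "real n * \<beta> > 0" using that assms(4) by simp
    then show ?thesis using lapL_surj[OF assms(1)] by metis
  qed
  then obtain p where p: "\<And>n. n \<ge> 1 \<Longrightarrow> p n > 0" "\<And>n. n \<ge> 1 \<Longrightarrow> lapL k (p n) = real n * \<beta>"
    by metis
  \<comment> \<open>Function and constant are bundled into one predicate so that both are chosen
    together for each n.\<close>
  define P where "P n h C \<longleftrightarrow> real_analytic_on h {0<..} \<and>
      (AE t in lborel. t > 0 \<longrightarrow> kappa k \<mu> \<beta> n t = ennreal (h t)) \<and>
      C > 0 \<and> ((\<lambda>t. h t * exp (- p n * t)) \<longlongrightarrow> C) at_top" for n h C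
  have "\<exists>h C. P n h C" if "n \<ge> 1" for n
  proof (rule kappa_asymptotics[OF assms that p(1)[OF that] p(2)[OF that]])
    fix h C
    assume "real_analytic_on h {0<..}" "AE t in lborel. t > 0 \<longrightarrow> kappa k \<mu> \<beta> n t = ennreal (h t)"
      "C > 0" "((\<lambda>t. h t * exp (- p n * t)) \<longlongrightarrow> C) at_top"
    then have "P n h C" unfolding P_def by (intro conjI)
    then show ?thesis by blast
  qed
  then obtain h C where P: "\<And>n. n \<ge> 1 \<Longrightarrow> P n (h n) (C n)"
    by metis
  have h: "real_analytic_on (h n) {0<..}" "AE t in lborel. t > 0 \<longrightarrow> kappa k \<mu> \<beta> n t = ennreal (h n t)"
    and C: "C n > 0" and lim: "((\<lambda>t. h n t * exp (- p n * t)) \<longlongrightarrow> C n) at_top" if "n \<ge> 1" for n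
    using P[OF that] by (auto simp: P_def)
  show ?thesis
  proof (intro conjI allI impI)
    fix n :: nat assume n: "n \<ge> 1"
    show "AE t in lborel. t > 0 \<longrightarrow> kappa k \<mu> \<beta> n t < \<infinity>"
      using h(2)[OF n] by eventually_elim auto
    show "\<exists>f. real_analytic_on f {0<..} \<and> (AE t in lborel. t > 0 \<longrightarrow> kappa k \<mu> \<beta> n t = ennreal (f t))"
      using h[OF n] by blast
  next
    fix f :: "nat \<Rightarrow> real \<Rightarrow> real" and n :: nat and ms :: "nat list"
    assume f: "\<forall>n\<ge>1. real_analytic_on (f n) {0<..} \<and> (AE t in lborel. t > 0 \<longrightarrow> kappa k \<mu> \<beta> n t = ennreal (f n t))"
      and n: "n > 1" and ms: "length ms \<ge> 2" "\<forall>m\<in>set ms. m \<ge> 1" "sum_list ms = n"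
    \<comment> \<open>The claim concerns every analytic version, not only the constructed
      \<open>h\<close>. Equality under \<open>ennreal\<close> says nothing about negative values, so
      the two are compared only beyond T, where \<open>h\<close> is known to be positive; that is
      enough for the limit.\<close>
    have f_lim: "((\<lambda>t. f m t * exp (- p m * t)) \<longlongrightarrow> C m) at_top" if m: "m \<ge> 1" for m
    proof -
      have "\<forall>\<^sub>F t in at_top. h m t * exp (- p m * t) > 0"
        using lim[OF m] C[OF m] by (rule order_tendstoD)
      then obtain T0 where T0: "\<And>t. t \<ge> T0 \<Longrightarrow> h m t * exp (- p m * t) > 0"
        by (auto simp: eventually_at_top_linorder)
      define T where "T = max 0 T0"
      have pos: "h m t > 0" if "t > T" for t
        using T0[of t] that by (simp add: T_def zero_less_mult_iff)
      have "f m t = h m t" if t: "t \<in> {T<..}" for t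
      proof (rule AE_eq_imp_eq_on_open[OF _ _ _ _ t])
        have "isCont (f m) x" "isCont (h m) x" if "x > T" for x
          using that f m h(1)[OF m] by (auto simp: T_def intro!: real_analytic_on_imp_isCont[of _ "{0<..}"])
        then show "continuous_on {T<..} (f m)" "continuous_on {T<..} (h m)"
          by (auto intro!: continuous_at_imp_continuous_on)
        have "AE t in lborel. t > 0 \<longrightarrow> kappa k \<mu> \<beta> m t = ennreal (f m t)" using f m by blast
        with h(2)[OF m] show "AE t in lborel. t \<in> {T<..} \<longrightarrow> f m t = h m t"
        proof eventually_elim
          case (elim t)
          show ?case
          proof
            assume t: "t \<in> {T<..}"
            then have "ennreal (h m t) = ennreal (f m t)" "h m t > 0" using elim pos by (auto simp: T_def)
            then show "f m t = h m t"
              by (metis ennreal_inj ennreal_eq_0_iff less_imp_le linear not_less)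
          qed
        qed
      qed simp
      then have "\<forall>\<^sub>F t in at_top. h m t * exp (- p m * t) = f m t * exp (- p m * t)"
        by (intro eventually_mono[OF eventually_gt_at_top[of T]]) simp
      with lim[OF m] show ?thesis by (rule Lim_transform_eventually)
    qed
    define s where "s = sum_list (map p ms)"
    have gap: "p n - s > 0"
      using exponents_strictly_superadditive[OF assms(1) p ms(1,2)] ms(3) by (simp add: s_def)
    define c where "c = prod_list (map C ms)"
    have "0 < prod_list (map C xs)" if "\<forall>m\<in>set xs. m \<ge> 1" for xs
      using that by (induction xs) (auto intro!: mult_pos_pos C)
    then have c: "c > 0" using ms(2) by (simp add: c_def)
    have "((\<lambda>t. prod_list (map (\<lambda>m. f m t) ms) * exp (- s * t)) \<longlongrightarrow> c) at_top"
      unfolding s_def c_def using ms(2) by (intro prod_list_exp_asymptotics f_lim) auto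
    then have ratio: "((\<lambda>t. (f n t * exp (- p n * t)) / (prod_list (map (\<lambda>m. f m t) ms) * exp (- s * t))) \<longlongrightarrow> C n / c) at_top"
      using n c by (intro tendsto_divide f_lim) auto
    \<comment> \<open>The normalised quotient tends to the positive number \<open>C n / c\<close>;
      what remains is an exponential whose rate is the superadditivity gap.\<close>
    have "filterlim (\<lambda>t. exp ((p n - s) * t)) at_top at_top"
      using gap by real_asymp
    then have "filterlim (\<lambda>t. (f n t * exp (- p n * t)) / (prod_list (map (\<lambda>m. f m t) ms) * exp (- s * t)) * exp ((p n - s) * t)) at_top at_top"
      using ratio C[of n] n c by (intro filterlim_tendsto_pos_mult_at_top[OF ratio]) auto
    moreover have "(f n t * exp (- p n * t)) / (prod_list (map (\<lambda>m. f m t) ms) * exp (- s * t)) * exp ((p n - s) * t) =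
        f n t / prod_list (map (\<lambda>m. f m t) ms)" for t
    proof -
      have "exp (- p n * t) * exp ((p n - s) * t) = exp (- s * t)"
        by (simp add: exp_add[symmetric] algebra_simps)
      then have "(f n t * exp (- p n * t)) * exp ((p n - s) * t) = f n t * exp (- s * t)"
        by (simp only: mult.assoc)
      then show ?thesis by (simp only: times_divide_eq_left) simp
    qed
    ultimately show "filterlim (\<lambda>t. f n t / prod_list (map (\<lambda>m. f m t) ms)) at_top at_top"
      by simp
  qed
qed

end
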